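(* Let $n\ge1$. For a family $\mathcal{J}\subseteq 2^{[n-1]}$ let $D_{\mathcal{J},n}^{-1}=\{\pi\in\mathfrak{S}_n:\mathrm{Des}(\pi^{-1})\in\mathcal{J}\}$, equipped with the usual descent map $\mathrm{Des}$ on permutations. 1. For $J\subseteq[n-1]$, the set $D_{2^J,n}^{-1}$ has a cyclic descent extension if and only if $J\ne\emptyset$. 2. For an interval $[I,J]=\{K: I\subseteq K\subseteq J\}$ in the poset $2^{[n-1]}$ ordered by inclusion (with $I\subseteq J$), the set $D_{[I,J],n}^{-1}$ has a cyclic descent extension if and only if $I\subsetneq J$. 3. For every maximal chain $C$ in the poset $[I,J]$, the set $D_{C,n}^{-1}$ has a cyclic descent extension if and only if $|J|-|I|$ is odd. In particular, for a maximal chain $C$ in $2^{[n-1]}$, the set $D_{C,n}^{-1}$ has a cyclic descent extension if and only if $n-1$ is odd, equivalently $n$ is even.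
   Context: $[m]=\{1,\dots,m\}$; $2^X$ is the power set of $X$; $\mathfrak{S}_n$ is the symmetric group on $[n]$. For $\pi\in\mathfrak{S}_n$, $\mathrm{Des}(\pi)=\{1\le i\le n-1:\pi(i)>\pi(i+1)\}$. Cyclic descent extension: let $\mathcal{T}$ be a finite set with a map $\mathrm{Des}:\mathcal{T}\to2^{[n-1]}$. Let $\mathrm{sh}:2^{[n]}\to2^{[n]}$ be the cyclic shift, $\mathrm{sh}(P)=\{i+1 \bmod n: i\in P\}$ (with representatives in $[n]$). A cyclic descent extension on $\mathcal{T}$ is a pair $(\mathrm{cDes},p)$ with $\mathrm{cDes}:\mathcal{T}\to2^{[n]}$ a map and $p:\mathcal{T}\to\mathcal{T}$ a bijection such that for all $T\in\mathcal{T}$: (extension) $\mathrm{cDes}(T)\cap[n-1]=\mathrm{Des}(T)$; (equivariance) $\mathrm{cDes}(p(T))=\mathrm{sh}(\mathrm{cDes}(T))$; (non-Escher) $\emptyset\subsetneq\mathrm{cDes}(T)\subsetneq[n]$. *)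

theory Defs
  imports "HOL-Combinatorics.Permutations"
begin

definition sh :: "nat \<Rightarrow> nat set \<Rightarrow> nat set" where
  "sh n P = (\<lambda>i. i mod n + 1) ` P"

(* Residues modulo n are represented in {1..n}, so the element n is sent to 1. *)
lemma sh_element:
  fixes i n :: nat
  assumes "i \<in> {1..n}"
  shows "i mod n + 1 = (if i = n then 1 else i + 1)"
  using assms by auto

(* T is meant to be a finite set and D a map from T to subsets of {1..n-1};
   finite_inverse_descent_class and Des_subset below show this for the sets of
   permutations considered here. *)
definition is_cyclic_descent_extension ::
  "nat \<Rightarrow> 'a set \<Rightarrow> ('a \<Rightarrow> nat set) \<Rightarrow> ('a \<Rightarrow> nat set) \<Rightarrow> ('a \<Rightarrow> 'a) \<Rightarrow> bool" where
  "is_cyclic_descent_extension n T D cDes p \<longleftrightarrow>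
     (\<forall>t\<in>T. cDes t \<subseteq> {1..n}) \<and>
     bij_betw p T T \<and>
     (\<forall>t\<in>T. cDes t \<inter> {1..n - 1} = D t) \<and>
     (\<forall>t\<in>T. cDes (p t) = sh n (cDes t)) \<and>
     (\<forall>t\<in>T. {} \<subset> cDes t \<and> cDes t \<subset> {1..n})"

definition has_cyclic_descent_extension ::
  "nat \<Rightarrow> 'a set \<Rightarrow> ('a \<Rightarrow> nat set) \<Rightarrow> bool" where
  "has_cyclic_descent_extension n T D \<longleftrightarrow>
     (\<exists>cDes p. is_cyclic_descent_extension n T D cDes p)"

definition Des :: "nat \<Rightarrow> (nat \<Rightarrow> nat) \<Rightarrow> nat set" where
  "Des n \<pi> = {i \<in> {1..n - 1}. \<pi> i > \<pi> (i + 1)}"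

(* A permutation of {1..n} is a function that is the identity outside {1..n};
   its inverse as a bijection of all of nat is then again such a function. *)
definition inverse_descent_class :: "nat \<Rightarrow> nat set set \<Rightarrow> (nat \<Rightarrow> nat) set" where
  "inverse_descent_class n \<J> = {\<pi>. \<pi> permutes {1..n} \<and> Des n (inv \<pi>) \<in> \<J>}"

lemma Des_subset: "Des n \<pi> \<subseteq> {1..n - 1}"
  by (auto simp: Des_def)

lemma finite_inverse_descent_class: "finite (inverse_descent_class n \<J>)"
  by (rule finite_subset[OF _ finite_permutations[of "{1..n}"]])
    (auto simp: inverse_descent_class_def)

end

theory Submission
  imports Defs "HOL-Library.Product_Lexorder"
begin

text \<open>
  A cyclic descent extension exists as soon as there are numbers \<open>m P\<close> for \<open>P \<subseteq> {1..n}\<close>, invariant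
  under the cyclic shift and zero for \<open>{}\<close> and \<open>{1..n}\<close>, such that \<open>m Q + m (insert n Q)\<close> is the number
  of elements with descent set \<open>Q\<close> (\<open>has_cyclic_descent_extension_of_fibre_sizes\<close>).

  For the permutations whose inverse descents lie in a fixed nonempty set \<open>L\<close>, such numbers come from words.
  These permutations are the standardizations of the words with a fixed content, one letter for
  each block of values between elements of \<open>L\<close>.  Standardization preserves descents,
  words can be rotated, and every word has a cyclic descent and a cyclic ascent.

  Next, take a covering relation \<open>{K, insert j K}\<close>.  The alternating sum over \<open>L \<subseteq> K\<close> of the numbers
  for \<open>insert j L\<close> satisfies all the equations by linearity, and what has to be proved is that
  it is not negative.  Since \<open>j\<close> is a separator in every term, the sum can be refined by the set
  \<open>A\<close> of positions of the values up to \<open>j\<close>, a nonempty proper subset of the cycle.  Rotate until \<open>A\<close>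
  contains \<open>n\<close> but not \<open>1\<close>.  Then the step from \<open>n\<close> to \<open>1\<close> is always an ascent, the cyclic descent set
  is the ordinary one, and by inclusion-exclusion the sum counts the permutations
  with \<open>Des n (inv \<pi>) - {j} = K\<close> that have this \<open>A\<close> and this descent set
  (\<open>signed_count_nonneg_boundary\<close>).

  An interval \<open>{I..J}\<close> with \<open>I \<subset> J\<close> is partitioned into covering relations by adding or removing some
  \<open>j \<in> J - I\<close>, and a maximal chain with an even number of members by pairing consecutive ones.

  Conversely, an extension forces the family of inverse descent sets to have an even number of
  members (\<open>even_card_of_cyclic_descent_extension\<close>).  Each inverse descent set is attained by exactly
  one permutation with an initial segment \<open>{1..k}\<close> as its descent set, and shifting \<open>insert n {1..k}\<close> to
  \<open>{1..k + 1}\<close> pairs these permutations.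
\<close>

section \<open>Permutations given by the order of their values\<close>

lemma less_of_adjacent_less:
  assumes "\<And>i. \<lbrakk>a \<le> i; i < b\<rbrakk> \<Longrightarrow> f i < (f (Suc i) :: 'a::order)" and "a < b"
  shows "f a < f b"
proof -
  have "Suc a \<le> b \<Longrightarrow> (\<And>i. \<lbrakk>a \<le> i; i < b\<rbrakk> \<Longrightarrow> f i < f (Suc i)) \<Longrightarrow> f a < f b"
    by (induction b rule: nat_induct_at_least) (auto intro: less_trans)
  then show ?thesis using assms by simp
qed

lemma permutes_inv_in:
  assumes "\<pi> permutes {1..n::nat}" "v \<in> {1..n}"
  shows "inv \<pi> v \<in> {1..n}"
  using permutes_in_image[OF permutes_inv[OF assms(1)]] assms(2) by blast

text \<open>
  The map \<open>rank_map n key\<close> is the standardization of the sequence \<open>key 1, ..., key n\<close>.  It builds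
  permutations with a prescribed relative order of values, and by \<open>eq_rank_map\<close> it also
  identifies them: a permutation is determined by the order in which it sorts its arguments.
\<close>
definition rank_map :: "nat \<Rightarrow> (nat \<Rightarrow> 'k::linorder) \<Rightarrow> nat \<Rightarrow> nat" where
  "rank_map n key i = (if i \<in> {1..n} then card {u \<in> {1..n}. key u \<le> key i} else i)"

lemma rank_map_le_iff:
  assumes "u \<in> {1..n}" "i \<in> {1..n}"
  shows "rank_map n key u \<le> rank_map n key i \<longleftrightarrow> key u \<le> key i"
proof
  assume "key u \<le> key i"
  then show "rank_map n key u \<le> rank_map n key i"
    using assms by (auto simp: rank_map_def intro!: card_mono)
next
  assume le: "rank_map n key u \<le> rank_map n key i"
  show "key u \<le> key i"
  proof (rule ccontr)
    assume "\<not> key u \<le> key i"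
    then have "{v \<in> {1..n}. key v \<le> key i} \<subset> {v \<in> {1..n}. key v \<le> key u}"
      using assms by auto
    then have "card {v \<in> {1..n}. key v \<le> key i} < card {v \<in> {1..n}. key v \<le> key u}"
      by (intro psubset_card_mono) auto
    then show False using le assms by (simp add: rank_map_def)
  qed
qed

lemma rank_map_permutes:
  assumes "inj_on key {1..n}"
  shows "rank_map n key permutes {1..n}"
proof (rule bij_imp_permutes)
  have sub: "rank_map n key ` {1..n} \<subseteq> {1..n}"
  proof safe
    fix i assume i: "i \<in> {1..n}"
    have "{u \<in> {1..n}. key u \<le> key i} \<noteq> {}" using i by blast
    then have "0 < card {u \<in> {1..n}. key u \<le> key i}" by (simp add: card_gt_0_iff)
    moreover have "card {u \<in> {1..n}. key u \<le> key i} \<le> card {1..n}"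
      by (rule card_mono) auto
    ultimately show "rank_map n key i \<in> {1..n}" using i by (simp add: rank_map_def)
  qed
  have "inj_on (rank_map n key) {1..n}"
  proof (rule inj_onI)
    fix u i assume ui: "u \<in> {1..n}" "i \<in> {1..n}" "rank_map n key u = rank_map n key i"
    then have "key u \<le> key i" "key i \<le> key u" using rank_map_le_iff by (metis order_refl)+
    then show "u = i" using assms ui by (auto dest: inj_onD)
  qed
  with sub show "bij_betw (rank_map n key) {1..n} {1..n}"
    by (simp add: bij_betw_def endo_inj_surj)
qed (auto simp: rank_map_def)

lemma card_permutes_le:
  assumes "\<pi> permutes {1..n::nat}" "l \<le> n"
  shows "card {u \<in> {1..n}. \<pi> u \<le> l} = l"
proof -
  have "\<pi> ` {u \<in> {1..n}. \<pi> u \<le> l} = {1..l}"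
  proof (rule antisym; rule subsetI)
    fix x assume x: "x \<in> {1..l}"
    then have "inv \<pi> x \<in> {1..n}" "\<pi> (inv \<pi> x) = x"
      using assms(2) permutes_inv_in[OF assms(1), of x] permutes_inverses(1)[OF assms(1)] by auto
    then show "x \<in> \<pi> ` {u \<in> {1..n}. \<pi> u \<le> l}" using x by (auto intro!: image_eqI[of _ _ "inv \<pi> x"])
  next
    fix x assume "x \<in> \<pi> ` {u \<in> {1..n}. \<pi> u \<le> l}"
    then show "x \<in> {1..l}" using permutes_in_image[OF assms(1)] by auto
  qed
  then have "card {1..l} = card {u \<in> {1..n}. \<pi> u \<le> l}"
    using permutes_inj_on[OF assms(1)] by (metis card_image)
  then show ?thesis by simp
qed

lemma eq_rank_map:
  assumes p: "\<pi> permutes {1..n}"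
    and mono: "\<And>u i. \<lbrakk>u \<in> {1..n}; i \<in> {1..n}; \<pi> u < \<pi> i\<rbrakk> \<Longrightarrow> key u < key i"
  shows "\<pi> = rank_map n key"
proof
  fix i
  show "\<pi> i = rank_map n key i"
  proof (cases "i \<in> {1..n}")
    case True
    have "\<pi> u \<le> \<pi> i \<longleftrightarrow> key u \<le> key i" if u: "u \<in> {1..n}" for u
    proof -
      consider "\<pi> u < \<pi> i" | "u = i" | "\<pi> i < \<pi> u"
        using permutes_inj[OF p] by (metis injD linorder_neqE_nat)
      then show ?thesis
        using mono[OF u True] mono[OF True u] by cases auto
    qed
    then have "{u \<in> {1..n}. key u \<le> key i} = {u \<in> {1..n}. \<pi> u \<le> \<pi> i}" by auto
    moreover have "\<pi> i \<le> n" using permutes_in_image[OF p] True by fastforce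
    ultimately show ?thesis using True card_permutes_le[OF p] by (simp add: rank_map_def)
  next
    case False
    then show ?thesis using permutes_not_in[OF p] by (simp only: rank_map_def if_False)
  qed
qed

section \<open>Words as sorted permutations\<close>

text \<open>
  A set \<open>L\<close> of separators cuts the values \<open>1..n\<close> into blocks, a new block starting after each
  \<open>l \<in> L\<close>.  Replacing every value of a permutation by its block gives a word of length \<open>n\<close> whose
  content is determined by \<open>L\<close>.  Instead of naming the letters, two permutations are compared by
  which values lie at or below each separator; this keeps the words for different \<open>L\<close>
  comparable.
\<close>
definition same_word :: "nat \<Rightarrow> nat set \<Rightarrow> (nat \<Rightarrow> nat) \<Rightarrow> (nat \<Rightarrow> nat) \<Rightarrow> bool" where
  "same_word n L \<pi> \<sigma> \<longleftrightarrow> (\<forall>i\<in>{1..n}. \<forall>l\<in>L. \<pi> i \<le> l \<longleftrightarrow> \<sigma> i \<le> l)"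

text \<open>
  Membership in the class says that the inverse ascends at every step that does not cross a
  separator.  So two values with no separator between them occur from left to right.
\<close>
lemma sorted_within_block:
  assumes p: "\<pi> \<in> inverse_descent_class n (Pow L)"
    and ui: "u \<in> {1..n}" "i \<in> {1..n}" "\<pi> u < \<pi> i" and no: "\<And>l. l \<in> L \<Longrightarrow> \<not> (\<pi> u \<le> l \<and> l < \<pi> i)"
  shows "u < i"
proof -
  have pp: "\<pi> permutes {1..n}" and D: "Des n (inv \<pi>) \<subseteq> L"
    using p by (auto simp: inverse_descent_class_def)
  have bounds: "1 \<le> \<pi> u" "\<pi> i \<le> n" using permutes_in_image[OF pp] ui by fastforce+
  have "inv \<pi> (\<pi> u) < inv \<pi> (\<pi> i)"
  proof (rule less_of_adjacent_less[OF _ ui(3)])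
    fix v assume v: "\<pi> u \<le> v" "v < \<pi> i"
    then have "v \<notin> Des n (inv \<pi>)" using no D by auto
    moreover have "v \<in> {1..n - 1}" using v bounds by auto
    ultimately have "inv \<pi> v \<le> inv \<pi> (Suc v)" by (auto simp: Des_def)
    moreover have "inv \<pi> v \<noteq> inv \<pi> (Suc v)"
      using permutes_inj[OF permutes_inv[OF pp]] by (metis injD n_not_Suc_n)
    ultimately show "inv \<pi> v < inv \<pi> (Suc v)" by simp
  qed
  then show ?thesis using permutes_inverses(2)[OF pp] by simp
qed

text \<open>
  Among the permutations with a given word, the one in which each block is written increasingly:
  the standardization of the word, with ties between equal letters broken by position.  The letter
  at \<open>i\<close> is encoded as the number of separators below \<open>\<sigma> i\<close>.
\<close>
definition sort_word :: "nat \<Rightarrow> nat set \<Rightarrow> (nat \<Rightarrow> nat) \<Rightarrow> nat \<Rightarrow> nat" where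
  "sort_word n L \<sigma> = rank_map n (\<lambda>i. (card {l \<in> L. l < \<sigma> i}, i))"

lemma sort_word_permutes: "sort_word n L \<sigma> permutes {1..n}"
  unfolding sort_word_def by (rule rank_map_permutes) (rule inj_onI, simp)

lemma card_below_mono:
  assumes "finite L" "l \<in> L" "(x::nat) \<le> l" "l < y"
  shows "card {l \<in> L. l < x} < card {l \<in> L. l < y}"
proof (rule psubset_card_mono)
  have "l \<in> {l \<in> L. l < y}" "l \<notin> {l \<in> L. l < x}" using assms by simp_all
  moreover have "{l \<in> L. l < x} \<subseteq> {l \<in> L. l < y}"
    using assms(3,4) by (intro Collect_mono) simp
  ultimately show "{l \<in> L. l < x} \<subset> {l \<in> L. l < y}" by blast
qed (simp add: assms(1))

text \<open>
  The positions of values at most \<open>l\<close> form an initial segment of size \<open>l\<close> in the order by keys, so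
  these positions are exactly the ones of rank at most \<open>l\<close>.
\<close>
lemma same_word_sort_word:
  assumes s: "\<sigma> permutes {1..n}" and L: "L \<subseteq> {1..n}"
  shows "same_word n L (sort_word n L \<sigma>) \<sigma>"
  unfolding same_word_def
proof (intro ballI)
  fix i l assume i: "i \<in> {1..n}" and l: "l \<in> L"
  have fL: "finite L" using L finite_subset by blast
  let ?key = "\<lambda>i. (card {l \<in> L. l < \<sigma> i}, i)"
  let ?X = "{u \<in> {1..n}. \<sigma> u \<le> l}"
  have cX: "card ?X = l" using card_permutes_le[OF s] l L by auto
  have r: "sort_word n L \<sigma> i = card {u \<in> {1..n}. ?key u \<le> ?key i}"
    unfolding sort_word_def rank_map_def using i by simp
  show "sort_word n L \<sigma> i \<le> l \<longleftrightarrow> \<sigma> i \<le> l"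
  proof
    assume il: "\<sigma> i \<le> l"
    have "{u \<in> {1..n}. ?key u \<le> ?key i} \<subseteq> ?X"
    proof
      fix u assume u: "u \<in> {u \<in> {1..n}. ?key u \<le> ?key i}"
      then have "card {l \<in> L. l < \<sigma> u} \<le> card {l \<in> L. l < \<sigma> i}" by auto
      then have "\<not> l < \<sigma> u" using card_below_mono[OF fL l il, of "\<sigma> u"] by linarith
      then show "u \<in> ?X" using u by simp
    qed
    then have "card {u \<in> {1..n}. ?key u \<le> ?key i} \<le> card ?X" by (intro card_mono) auto
    then show "sort_word n L \<sigma> i \<le> l" using r cX by simp
  next
    assume rl: "sort_word n L \<sigma> i \<le> l"
    show "\<sigma> i \<le> l"
    proof (rule ccontr)
      assume il: "\<not> \<sigma> i \<le> l"
      have "insert i ?X \<subseteq> {u \<in> {1..n}. ?key u \<le> ?key i}"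
      proof
        fix u assume u: "u \<in> insert i ?X"
        show "u \<in> {u \<in> {1..n}. ?key u \<le> ?key i}"
        proof (cases "u = i")
          case False
          then have "card {l \<in> L. l < \<sigma> u} < card {l \<in> L. l < \<sigma> i}"
            using u il by (intro card_below_mono[OF fL l]) auto
          then show ?thesis using u False by simp
        qed (use i in simp)
      qed
      then have "card (insert i ?X) \<le> card {u \<in> {1..n}. ?key u \<le> ?key i}" by (intro card_mono) auto
      moreover have "card (insert i ?X) = Suc l" using cX il by (subst card_insert_disjoint) auto
      ultimately show False using r rl by simp
    qed
  qed
qed

lemma same_word_below:
  "\<lbrakk>same_word n L \<pi> \<sigma>; i \<in> {1..n}\<rbrakk> \<Longrightarrow> {l \<in> L. l < \<pi> i} = {l \<in> L. l < \<sigma> i}"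
proof -
  assume w: "same_word n L \<pi> \<sigma>" and i: "i \<in> {1..n}"
  have "l < \<pi> i \<longleftrightarrow> l < \<sigma> i" if "l \<in> L" for l
    using w i that unfolding same_word_def not_le[symmetric] by blast
  then show ?thesis by blast
qed

lemma sort_word_in_class:
  assumes s: "\<sigma> permutes {1..n}" and L: "L \<subseteq> {1..n}"
  shows "sort_word n L \<sigma> \<in> inverse_descent_class n (Pow L)"
proof -
  let ?\<pi> = "sort_word n L \<sigma>"
  let ?key = "\<lambda>i. (card {l \<in> L. l < \<sigma> i}, i)"
  have p: "?\<pi> permutes {1..n}" by (rule sort_word_permutes)
  have "Des n (inv ?\<pi>) \<subseteq> L"
  proof
    fix v assume v: "v \<in> Des n (inv ?\<pi>)"
    let ?i = "inv ?\<pi> v" and ?i' = "inv ?\<pi> (v + 1)"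
    have vn: "v \<in> {1..n}" "v + 1 \<in> {1..n}" and gt: "?i' < ?i" using v by (auto simp: Des_def)
    have ii: "?i \<in> {1..n}" "?i' \<in> {1..n}" using permutes_inv_in[OF p] vn by blast+
    have val: "?\<pi> ?i = v" "?\<pi> ?i' = v + 1" using permutes_inverses(1)[OF p] by auto
    show "v \<in> L"
    proof (rule ccontr)
      assume "v \<notin> L"
      then have "{l \<in> L. l < v + 1} = {l \<in> L. l < v}" by (auto simp: less_Suc_eq)
      then have "{l \<in> L. l < \<sigma> ?i'} = {l \<in> L. l < \<sigma> ?i}"
        using same_word_below[OF same_word_sort_word[OF s L]] ii val by metis
      then have "?key ?i' \<le> ?key ?i" using gt by simp
      then have "?\<pi> ?i' \<le> ?\<pi> ?i" unfolding sort_word_def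
        using rank_map_le_iff[OF ii(2,1), of ?key] unfolding sort_word_def by blast
      then show False using val by simp
    qed
  qed
  then show ?thesis using p by (simp add: inverse_descent_class_def)
qed

text \<open>
  Together with \<open>sort_word_in_class\<close> this identifies \<open>inverse_descent_class n (Pow L)\<close> with the
  words of the content given by \<open>L\<close>.
\<close>
lemma sort_word_unique:
  assumes p: "\<pi> \<in> inverse_descent_class n (Pow L)" and L: "finite L" and w: "same_word n L \<pi> \<sigma>"
  shows "\<pi> = sort_word n L \<sigma>"
  unfolding sort_word_def
proof (rule eq_rank_map)
  show "\<pi> permutes {1..n}" using p by (simp add: inverse_descent_class_def)
next
  fix u i assume ui: "u \<in> {1..n}" "i \<in> {1..n}" "\<pi> u < \<pi> i"
  have eq: "{l \<in> L. l < \<sigma> u} = {l \<in> L. l < \<pi> u}" "{l \<in> L. l < \<sigma> i} = {l \<in> L. l < \<pi> i}"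
    using same_word_below[OF w] ui by auto
  show "(card {l \<in> L. l < \<sigma> u}, u) < (card {l \<in> L. l < \<sigma> i}, i)"
  proof (cases "\<exists>l\<in>L. \<pi> u \<le> l \<and> l < \<pi> i")
    case True
    then show ?thesis unfolding eq using card_below_mono[OF L] by auto
  next
    case False
    moreover have "card {l \<in> L. l < \<pi> u} \<le> card {l \<in> L. l < \<pi> i}"
      using ui L by (intro card_mono) auto
    ultimately show ?thesis unfolding eq using sorted_within_block[OF p ui] by auto
  qed
qed

section \<open>Rotation and cyclic descents of words\<close>

definition rot :: "nat \<Rightarrow> nat \<Rightarrow> nat" where
  "rot n i = (if i \<in> {1..n} then i mod n + 1 else i)"

lemma rot_simps: "\<lbrakk>i \<in> {1..n}; i \<noteq> n\<rbrakk> \<Longrightarrow> rot n i = i + 1" "1 \<le> n \<Longrightarrow> rot n n = 1"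
  by (auto simp: rot_def)

lemma rot_permutes: "rot n permutes {1..n}"
proof (rule bij_imp_permutes)
  have sub: "rot n ` {1..n} \<subseteq> {1..n}" by (auto simp: rot_def Suc_le_eq)
  have "inj_on (rot n) {1..n}"
  proof (rule inj_onI)
    fix x y assume "x \<in> {1..n}" "y \<in> {1..n}" "rot n x = rot n y"
    then show "x = y"
      by (cases "x = n"; cases "y = n") (auto simp: rot_def)
  qed
  with sub show "bij_betw (rot n) {1..n} {1..n}" by (simp add: bij_betw_def endo_inj_surj)
qed (auto simp: rot_def)

lemma rot_in: "i \<in> {1..n} \<Longrightarrow> rot n i \<in> {1..n}"
  using permutes_in_image[OF rot_permutes] by blast

lemma sh_eq_rot_image: "P \<subseteq> {1..n} \<Longrightarrow> sh n P = rot n ` P"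
  unfolding sh_def by (rule image_cong) (auto simp: rot_def)

lemma bij_betw_sh: "bij_betw (sh n) (Pow {1..n}) (Pow {1..n})"
proof -
  have "bij_betw ((`) (rot n)) (Pow {1..n}) (Pow {1..n})"
    by (rule bij_betw_Pow[OF permutes_imp_bij[OF rot_permutes]])
  then show ?thesis by (rule bij_betw_cong[THEN iffD2, rotated]) (simp add: sh_eq_rot_image)
qed

lemma sh_subset: "P \<subseteq> {1..n} \<Longrightarrow> sh n P \<subseteq> {1..n}"
  using bij_betw_sh[of n] by (auto simp: bij_betw_def)

lemma sh_eq_iff: "\<lbrakk>P \<subseteq> {1..n}; Q \<subseteq> {1..n}\<rbrakk> \<Longrightarrow> sh n P = sh n Q \<longleftrightarrow> P = Q"
  using bij_betw_sh[of n] by (auto simp: bij_betw_def inj_on_def)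

lemma rot_mem_sh: "\<lbrakk>P \<subseteq> {1..n}\<rbrakk> \<Longrightarrow> rot n i \<in> sh n P \<longleftrightarrow> i \<in> P"
  using permutes_inj[OF rot_permutes] by (simp add: sh_eq_rot_image inj_image_mem_iff)

lemma sh_Collect:
  "sh n {i \<in> {1..n}. R (rot n i)} = {i \<in> {1..n}. R i}"
proof -
  have "rot n ` {i \<in> {1..n}. R (rot n i)} = {i \<in> rot n ` {1..n}. R i}" by auto
  also have "\<dots> = {i \<in> {1..n}. R i}" by (simp only: permutes_image[OF rot_permutes])
  finally show ?thesis by (subst sh_eq_rot_image) auto
qed

text \<open>
  A set closed under the \<open>n\<close>-cycle is empty or everything.
\<close>
lemma exists_cyclic_boundary:
  assumes A: "A \<subseteq> {1..n}" "A \<noteq> {}" "A \<noteq> {1..n}"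
  shows "\<exists>i\<in>A. rot n i \<notin> A"
proof (rule ccontr)
  assume "\<not> ?thesis"
  then have closed: "\<And>i. i \<in> A \<Longrightarrow> rot n i \<in> A" by blast
  have up: "b \<in> A" if "a \<in> A" "a \<le> b" "b \<le> n" for a b
    using that(2,3)
  proof (induction b rule: dec_induct)
    case (step b)
    then have b: "b \<in> A" by simp
    then have "rot n b = Suc b" using A(1) step rot_simps(1)[of b n] by auto
    then show ?case using closed[OF b] by simp
  qed (use that in simp)
  obtain a where a: "a \<in> A" using A by blast
  then have "1 \<le> n" and "n \<in> A" using up[of a n] A(1) by auto
  then have "1 \<in> A" using closed[of n] rot_simps(2) by auto
  then have "{1..n} \<subseteq> A" using up[of 1] by auto
  then show False using A by blast
qed

text \<open>
  The cyclic descents of the word of \<open>\<pi>\<close>: one letter is larger than the next one exactly if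
  a separator lies between the two values.
\<close>
definition cyclic_word_descents :: "nat \<Rightarrow> nat set \<Rightarrow> (nat \<Rightarrow> nat) \<Rightarrow> nat set" where
  "cyclic_word_descents n L \<pi> = {i \<in> {1..n}. \<exists>l\<in>L. \<pi> (rot n i) \<le> l \<and> l < \<pi> i}"

definition low_positions :: "nat \<Rightarrow> nat \<Rightarrow> (nat \<Rightarrow> nat) \<Rightarrow> nat set" where
  "low_positions n j \<pi> = {i \<in> {1..n}. \<pi> i \<le> j}"

lemma cyclic_word_descents_subset: "cyclic_word_descents n L \<pi> \<subseteq> {1..n}"
  by (auto simp: cyclic_word_descents_def)

lemma low_positions_subset: "low_positions n j \<pi> \<subseteq> {1..n}"
  by (auto simp: low_positions_def)

text \<open>
  Cyclic rotation of the word, carried back to sorted permutations.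
\<close>
definition rotate_word :: "nat \<Rightarrow> nat set \<Rightarrow> (nat \<Rightarrow> nat) \<Rightarrow> nat \<Rightarrow> nat" where
  "rotate_word n L \<pi> = sort_word n L (\<pi> \<circ> inv (rot n))"

lemma rotated_permutes: "\<pi> permutes {1..n} \<Longrightarrow> (\<pi> \<circ> inv (rot n)) permutes {1..n}"
  by (rule permutes_compose[OF permutes_inv[OF rot_permutes]])

lemma rotate_word_same_word:
  assumes p: "\<pi> permutes {1..n}" and L: "L \<subseteq> {1..n}"
    and i: "i \<in> {1..n}" and l: "l \<in> L"
  shows "rotate_word n L \<pi> (rot n i) \<le> l \<longleftrightarrow> \<pi> i \<le> l"
  using same_word_sort_word[OF rotated_permutes[OF p] L] rot_in[OF i] l
  by (simp add: same_word_def rotate_word_def permutes_inverses[OF rot_permutes])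

lemma cyclic_word_descents_rotate_word:
  assumes "\<pi> permutes {1..n}" "L \<subseteq> {1..n}"
  shows "cyclic_word_descents n L (rotate_word n L \<pi>) = sh n (cyclic_word_descents n L \<pi>)"
proof -
  let ?\<rho> = "rotate_word n L \<pi>"
  have "cyclic_word_descents n L \<pi>
      = {i \<in> {1..n}. \<exists>l\<in>L. ?\<rho> (rot n (rot n i)) \<le> l \<and> l < ?\<rho> (rot n i)}"
    unfolding cyclic_word_descents_def not_le[symmetric]
    using rotate_word_same_word[OF assms] rot_in by blast
  then show ?thesis
    using sh_Collect[of n "\<lambda>i. \<exists>l\<in>L. ?\<rho> (rot n i) \<le> l \<and> l < ?\<rho> i"]
    by (simp only: cyclic_word_descents_def)
qed

lemma low_positions_rotate_word:
  assumes "\<pi> permutes {1..n}" "L \<subseteq> {1..n}" "j \<in> L"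
  shows "low_positions n j (rotate_word n L \<pi>) = sh n (low_positions n j \<pi>)"
proof -
  let ?\<rho> = "rotate_word n L \<pi>"
  have "low_positions n j \<pi> = {i \<in> {1..n}. ?\<rho> (rot n i) \<le> j}"
    unfolding low_positions_def using rotate_word_same_word[OF assms(1,2) _ assms(3)] by blast
  then show ?thesis
    using sh_Collect[of n "\<lambda>i. ?\<rho> i \<le> j"] by (simp only: low_positions_def)
qed

text \<open>
  A rotated word determines the word, and the word determines the sorted permutation.
\<close>
lemma rotate_word_bij:
  assumes L: "L \<subseteq> {1..n}"
  shows "bij_betw (rotate_word n L) (inverse_descent_class n (Pow L)) (inverse_descent_class n (Pow L))"
proof -
  let ?U = "inverse_descent_class n (Pow L)"
  have perm: "\<pi> permutes {1..n}" if "\<pi> \<in> ?U" for \<pi> using that by (simp add: inverse_descent_class_def)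
  have fL: "finite L" using L finite_subset by blast
  have sub: "rotate_word n L ` ?U \<subseteq> ?U"
    unfolding rotate_word_def using sort_word_in_class[OF rotated_permutes[OF perm] L] by blast
  have "inj_on (rotate_word n L) ?U"
  proof (rule inj_onI)
    fix \<pi> \<sigma> assume U: "\<pi> \<in> ?U" "\<sigma> \<in> ?U" and eq: "rotate_word n L \<pi> = rotate_word n L \<sigma>"
    have "same_word n L \<pi> \<sigma>" "same_word n L \<sigma> \<sigma>"
      unfolding same_word_def
      using rotate_word_same_word[OF perm[OF U(1)] L] rotate_word_same_word[OF perm[OF U(2)] L] eq
      by simp_all
    then show "\<pi> = \<sigma>" using sort_word_unique[OF U(1) fL] sort_word_unique[OF U(2) fL] by metis
  qed
  then show ?thesis using endo_inj_surj[OF finite_inverse_descent_class sub] by (simp add: bij_betw_def)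
qed

text \<open>
  In a sorted permutation a descent cannot stay inside a block, so permutation and word have the
  same descents.  Hence word rotation gives a cyclic descent extension of
  \<open>inverse_descent_class n (Pow L)\<close> when \<open>L\<close> is nonempty; the smaller classes are reached from here
  by inclusion-exclusion.
\<close>
lemma cyclic_word_descents_Int_eq_Des:
  assumes p: "\<pi> \<in> inverse_descent_class n (Pow L)"
  shows "cyclic_word_descents n L \<pi> \<inter> {1..n - 1} = Des n \<pi>"
proof -
  have "(\<exists>l\<in>L. \<pi> (rot n i) \<le> l \<and> l < \<pi> i) \<longleftrightarrow> \<pi> (i + 1) < \<pi> i" if i: "i \<in> {1..n - 1}" for i
  proof -
    have r: "rot n i = i + 1" using i by (intro rot_simps) auto
    have "\<exists>l\<in>L. \<pi> (i + 1) \<le> l \<and> l < \<pi> i" if "\<pi> (i + 1) < \<pi> i"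
      using sorted_within_block[OF p _ _ that] i by fastforce
    then show ?thesis unfolding r by auto
  qed
  moreover have "{1..n - 1} \<subseteq> {1..n}" by auto
  ultimately show ?thesis unfolding cyclic_word_descents_def Des_def by blast
qed

section \<open>Alternating sums of word counts\<close>

text \<open>
  The refinement by the set \<open>A\<close> of positions with value at most \<open>j\<close> is what makes the alternating
  sums below accessible: for each \<open>A\<close> there is a rotation after which the sum counts
  permutations.  Because \<open>j\<close> is a separator, \<open>A\<close> depends on the word only
  and rotates with it.
\<close>
definition word_count :: "nat \<Rightarrow> nat \<Rightarrow> nat set \<Rightarrow> nat set \<Rightarrow> nat set \<Rightarrow> nat" where
  "word_count n j L A P = card {\<pi> \<in> inverse_descent_class n (Pow (insert j L)).
     low_positions n j \<pi> = A \<and> cyclic_word_descents n (insert j L) \<pi> = P}"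

lemma word_count_sh:
  assumes L: "insert j L \<subseteq> {1..n}" and AP: "A \<subseteq> {1..n}" "P \<subseteq> {1..n}"
  shows "word_count n j L (sh n A) (sh n P) = word_count n j L A P"
proof -
  let ?U = "inverse_descent_class n (Pow (insert j L))" and ?r = "rotate_word n (insert j L)"
  let ?S = "\<lambda>A P. {\<pi> \<in> ?U. low_positions n j \<pi> = A \<and> cyclic_word_descents n (insert j L) \<pi> = P}"
  have bij: "bij_betw ?r ?U ?U" by (rule rotate_word_bij[OF L])
  have iff: "?r \<pi> \<in> ?S (sh n A) (sh n P) \<longleftrightarrow> \<pi> \<in> ?S A P" if U: "\<pi> \<in> ?U" for \<pi>
  proof -
    have p: "\<pi> permutes {1..n}" using U by (simp add: inverse_descent_class_def)
    have "?r \<pi> \<in> ?U" using bij U by (auto simp: bij_betw_def)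
    moreover have "low_positions n j (?r \<pi>) = sh n A \<longleftrightarrow> low_positions n j \<pi> = A"
      using low_positions_rotate_word[OF p L] sh_eq_iff[OF low_positions_subset AP(1)] by simp
    moreover have "cyclic_word_descents n (insert j L) (?r \<pi>) = sh n P
        \<longleftrightarrow> cyclic_word_descents n (insert j L) \<pi> = P"
      using cyclic_word_descents_rotate_word[OF p L] sh_eq_iff[OF cyclic_word_descents_subset AP(2)]
      by simp
    ultimately show ?thesis using U by simp
  qed
  have "?r ` ?S A P = ?S (sh n A) (sh n P)"
  proof (rule antisym; rule subsetI)
    fix x assume x: "x \<in> ?S (sh n A) (sh n P)"
    then have "x \<in> ?r ` ?U" using bij by (simp add: bij_betw_def)
    then obtain \<pi> where "\<pi> \<in> ?U" "x = ?r \<pi>" by (rule imageE) blast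
    then show "x \<in> ?r ` ?S A P" using iff x by blast
  next
    fix x assume "x \<in> ?r ` ?S A P"
    then show "x \<in> ?S (sh n A) (sh n P)" using iff by blast
  qed
  moreover have "card (?r ` ?S A P) = card (?S A P)"
    by (rule card_image, rule inj_on_subset[OF bij_betw_imp_inj_on[OF bij]]) blast
  ultimately show ?thesis unfolding word_count_def by (simp only:)
qed

text \<open>
  If the cyclic boundary from position \<open>n\<close> to position \<open>1\<close> goes from a value at most \<open>j\<close> to a value
  above \<open>j\<close>, then it is a cyclic ascent whatever the other separators are.  The cyclic descent set
  then carries no more information than the ordinary one.
\<close>
lemma word_count_cut:
  assumes n: "1 \<le> n" and A: "n \<in> A" "1 \<notin> A" and P: "P \<subseteq> {1..n}"
  shows "word_count n j L A P = (if n \<in> P then 0 else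
    card {\<pi> \<in> inverse_descent_class n (Pow (insert j L)). low_positions n j \<pi> = A \<and> Des n \<pi> = P})"
proof -
  let ?U = "inverse_descent_class n (Pow (insert j L))"
  have "low_positions n j \<pi> = A \<and> cyclic_word_descents n (insert j L) \<pi> = P
      \<longleftrightarrow> n \<notin> P \<and> low_positions n j \<pi> = A \<and> Des n \<pi> = P" if U: "\<pi> \<in> ?U" for \<pi>
  proof (cases "low_positions n j \<pi> = A")
    case True
    let ?c = "cyclic_word_descents n (insert j L) \<pi>"
    have "\<pi> n \<le> j" "j < \<pi> 1" using A True n by (auto simp: low_positions_def)
    then have "n \<notin> ?c"
      using rot_simps(2)[OF n] by (auto simp: cyclic_word_descents_def)
    moreover have "?c = Des n \<pi>"
    proof -
      have "x \<in> {1..n - 1}" if "x \<in> ?c" for x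
      proof -
        have "x \<in> {1..n}" "x \<noteq> n" using that cyclic_word_descents_subset \<open>n \<notin> ?c\<close> by blast+
        then show ?thesis by auto
      qed
      then have "?c \<subseteq> {1..n - 1}" by blast
      then show ?thesis using cyclic_word_descents_Int_eq_Des[OF U] by blast
    qed
    ultimately show ?thesis using True by auto
  qed simp
  then have "{\<pi> \<in> ?U. low_positions n j \<pi> = A \<and> cyclic_word_descents n (insert j L) \<pi> = P}
      = {\<pi> \<in> ?U. n \<notin> P \<and> low_positions n j \<pi> = A \<and> Des n \<pi> = P}"
    by blast
  then show ?thesis unfolding word_count_def by simp
qed

text \<open>
  Moebius inversion over the subsets of \<open>K\<close>: the condition \<open>Des n (inv \<pi>) \<subseteq> insert j L\<close> says that
  \<open>Des n (inv \<pi>) - {j}\<close> is one of the subsets of \<open>L\<close>.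
\<close>
lemma inverse_descent_inclusion_exclusion:
  assumes "finite K"
  shows "(\<Sum>L\<in>Pow K. (-1) ^ (card K - card L)
      * int (card {\<pi> \<in> inverse_descent_class n (Pow (insert j L)). X \<pi>}))
    = int (card {\<pi>. \<pi> permutes {1..n} \<and> Des n (inv \<pi>) - {j} = K \<and> X \<pi>})"
proof -
  let ?f = "\<lambda>K. {\<pi>. \<pi> permutes {1..n} \<and> Des n (inv \<pi>) - {j} = K \<and> X \<pi>}"
  let ?g = "\<lambda>L. {\<pi> \<in> inverse_descent_class n (Pow (insert j L)). X \<pi>}"
  have fin: "finite (?f L)" for L
    by (rule finite_subset[OF _ finite_permutations[of "{1..n}"]]) auto
  have "int (card (?g S)) = (\<Sum>L\<in>Pow S. int (card (?f L)))" if S: "finite S" for S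
  proof -
    have "?g S = (\<Union>L\<in>Pow S. ?f L)" by (auto simp: inverse_descent_class_def)
    moreover have "card (\<Union>L\<in>Pow S. ?f L) = (\<Sum>L\<in>Pow S. card (?f L))"
      using S fin by (intro card_UN_disjoint) auto
    ultimately show ?thesis by simp
  qed
  from inclusion_exclusion_mobius[of "\<lambda>S. int (card (?g S))", OF this assms] show ?thesis by simp
qed

definition signed_count :: "nat \<Rightarrow> nat \<Rightarrow> nat set \<Rightarrow> nat set \<Rightarrow> nat set \<Rightarrow> int" where
  "signed_count n j K A P =
     (\<Sum>L\<in>Pow K. (-1) ^ (card K - card L) * int (word_count n j L A P))"

lemma signed_count_sh:
  assumes "insert j K \<subseteq> {1..n}" "A \<subseteq> {1..n}" "P \<subseteq> {1..n}"
  shows "signed_count n j K (sh n A) (sh n P) = signed_count n j K A P"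
  unfolding signed_count_def
proof (rule sum.cong[OF refl])
  fix L assume "L \<in> Pow K"
  then have "word_count n j L (sh n A) (sh n P) = word_count n j L A P"
    using assms by (intro word_count_sh) auto
  then show "(- 1) ^ (card K - card L) * int (word_count n j L (sh n A) (sh n P)) =
         (- 1) ^ (card K - card L) * int (word_count n j L A P)" by simp
qed

text \<open>
  By rotation invariance the boundary from \<open>A\<close> to its complement can be moved from \<open>(i, i + 1)\<close>
  to \<open>(n, 1)\<close>.  There \<open>word_count_cut\<close> replaces cyclic by ordinary descents, and the alternating sum
  counts permutations.
\<close>
lemma signed_count_nonneg_boundary:
  assumes jK: "insert j K \<subseteq> {1..n}" and i: "i \<in> {1..n}"
    and A: "A \<subseteq> {1..n}" "i \<in> A" "rot n i \<notin> A" and P: "P \<subseteq> {1..n}"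
  shows "0 \<le> signed_count n j K A P"
proof -
  have "i \<le> n" using i by simp
  then show ?thesis using i A P
  proof (induction i arbitrary: A P rule: inc_induct)
    case base
    have n: "1 \<le> n" using base by simp
    have fK: "finite K" by (rule finite_subset[of _ "{1..n}"]) (use jK in auto)
    have cut: "word_count n j L A P = (if n \<in> P then 0 else
        card {\<pi> \<in> inverse_descent_class n (Pow (insert j L)). low_positions n j \<pi> = A \<and> Des n \<pi> = P})" for L
      using word_count_cut[OF n, of A P] base rot_simps(2)[OF n] by simp
    show ?case
      using inverse_descent_inclusion_exclusion[OF fK, of n j "\<lambda>\<pi>. low_positions n j \<pi> = A \<and> Des n \<pi> = P"]
      by (cases "n \<in> P") (simp_all add: signed_count_def cut)
  next
    case (step i)
    have r: "rot n i = Suc i" using step.hyps step.prems rot_simps(1)[of i n] by auto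
    have "0 \<le> signed_count n j K (sh n A) (sh n P)"
    proof (rule step.IH)
      show "Suc i \<in> sh n A" "rot n (Suc i) \<notin> sh n A"
        using step.prems rot_mem_sh[of A n i] rot_mem_sh[of A n "Suc i"] r by auto
      show "sh n A \<subseteq> {1..n}" "sh n P \<subseteq> {1..n}" using step.prems sh_subset by blast+
      show "Suc i \<in> {1..n}" using step.hyps by simp
    qed
    then show ?case using signed_count_sh[OF jK] step.prems by simp
  qed
qed

lemma low_positions_proper:
  assumes p: "\<pi> permutes {1..n}" and j: "j \<in> {1..n - 1}"
  shows "low_positions n j \<pi> \<noteq> {}" "low_positions n j \<pi> \<noteq> {1..n}"
proof -
  have "card (low_positions n j \<pi>) = j"
    unfolding low_positions_def using card_permutes_le[OF p] j by auto
  then show "low_positions n j \<pi> \<noteq> {}" "low_positions n j \<pi> \<noteq> {1..n}" using j by auto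
qed

text \<open>
  Since \<open>1 \<le> j < n\<close>, some values lie at or below \<open>j\<close> and some above it.  So only nonempty proper
  sets \<open>A\<close> contribute, and these have a boundary.
\<close>
lemma signed_count_nonneg:
  assumes j: "j \<in> {1..n - 1}" and K: "K \<subseteq> {1..n}" and A: "A \<subseteq> {1..n}" and P: "P \<subseteq> {1..n}"
  shows "0 \<le> signed_count n j K A P"
proof (cases "A = {} \<or> A = {1..n}")
  case True
  have "word_count n j L A P = 0" for L
  proof -
    have "{\<pi> \<in> inverse_descent_class n (Pow (insert j L)).
        low_positions n j \<pi> = A \<and> cyclic_word_descents n (insert j L) \<pi> = P} = {}"
      using low_positions_proper[OF _ j] True unfolding inverse_descent_class_def by blast
    then show ?thesis unfolding word_count_def by (simp only: card.empty)
  qed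
  then show ?thesis by (simp add: signed_count_def)
next
  case False
  then obtain i where "i \<in> A" "rot n i \<notin> A" using exists_cyclic_boundary[OF A] by blast
  moreover have "insert j K \<subseteq> {1..n}" using j K by auto
  ultimately show ?thesis using signed_count_nonneg_boundary[of j K n i A P] A P by blast
qed

text \<open>
  Around the cycle the values must pass from above \<open>j\<close> to at most \<open>j\<close>, which is a cyclic descent,
  and back, which is a cyclic ascent.
\<close>
lemma cyclic_word_descents_proper:
  assumes p: "\<pi> permutes {1..n}" and j: "j \<in> L" "j \<in> {1..n - 1}"
  shows "cyclic_word_descents n L \<pi> \<noteq> {}" "cyclic_word_descents n L \<pi> \<noteq> {1..n}"
proof -
  let ?A = "low_positions n j \<pi>"
  note pr = low_positions_proper[OF p j(2)]
  obtain i where i: "i \<in> ?A" "rot n i \<notin> ?A"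
    using exists_cyclic_boundary[OF low_positions_subset pr] by blast
  have "{1..n} - ?A \<subseteq> {1..n}" "{1..n} - ?A \<noteq> {}" "{1..n} - ?A \<noteq> {1..n}"
    using pr low_positions_subset[of n j \<pi>] by blast+
  from exists_cyclic_boundary[OF this]
  obtain u where u: "u \<in> {1..n} - ?A" "rot n u \<notin> {1..n} - ?A" by blast
  have "\<pi> i \<le> j" "j < \<pi> (rot n i)" "i \<in> {1..n}"
    using i rot_in[of i n] by (auto simp: low_positions_def)
  then have "i \<notin> cyclic_word_descents n L \<pi>" by (auto simp: cyclic_word_descents_def)
  then show "cyclic_word_descents n L \<pi> \<noteq> {1..n}" using \<open>i \<in> {1..n}\<close> by blast
  have "\<pi> (rot n u) \<le> j" "j < \<pi> u" "u \<in> {1..n}"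
    using u rot_in[of u n] by (auto simp: low_positions_def)
  then have "u \<in> cyclic_word_descents n L \<pi>" using j by (auto simp: cyclic_word_descents_def)
  then show "cyclic_word_descents n L \<pi> \<noteq> {}" by blast
qed

text \<open>
  The number of permutations that are to receive the cyclic descent set \<open>P\<close> in the family with
  inverse descent set \<open>K\<close> or \<open>insert j K\<close>.
\<close>
definition fibre_size :: "nat \<Rightarrow> nat \<Rightarrow> nat set \<Rightarrow> nat set \<Rightarrow> int" where
  "fibre_size n j K P = (\<Sum>A\<in>Pow {1..n}. signed_count n j K A P)"

lemma fibre_size_eq:
  "fibre_size n j K P = (\<Sum>L\<in>Pow K. (-1) ^ (card K - card L)
     * int (card {\<pi> \<in> inverse_descent_class n (Pow (insert j L)). cyclic_word_descents n (insert j L) \<pi> = P}))"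
proof -
  have *: "(\<Sum>A\<in>Pow {1..n}. int (word_count n j L A P))
    = int (card {\<pi> \<in> inverse_descent_class n (Pow (insert j L)). cyclic_word_descents n (insert j L) \<pi> = P})" for L
  proof -
    let ?S = "\<lambda>A. {\<pi> \<in> inverse_descent_class n (Pow (insert j L)).
       low_positions n j \<pi> = A \<and> cyclic_word_descents n (insert j L) \<pi> = P}"
    have "card (\<Union>A\<in>Pow {1..n}. ?S A) = (\<Sum>A\<in>Pow {1..n}. card (?S A))"
      using finite_inverse_descent_class by (intro card_UN_disjoint) auto
    moreover have "(\<Union>A\<in>Pow {1..n}. ?S A)
        = {\<pi> \<in> inverse_descent_class n (Pow (insert j L)). cyclic_word_descents n (insert j L) \<pi> = P}"
      using low_positions_subset by fastforce
    ultimately show ?thesis by (simp add: word_count_def)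
  qed
  have "fibre_size n j K P
      = (\<Sum>L\<in>Pow K. (-1) ^ (card K - card L) * (\<Sum>A\<in>Pow {1..n}. int (word_count n j L A P)))"
    unfolding fibre_size_def signed_count_def by (subst sum.swap) (simp only: sum_distrib_left)
  then show ?thesis by (simp only: *)
qed

lemma fibre_size_nonneg:
  assumes "j \<in> {1..n - 1}" "K \<subseteq> {1..n}" "P \<subseteq> {1..n}"
  shows "0 \<le> fibre_size n j K P"
  unfolding fibre_size_def using assms by (intro sum_nonneg signed_count_nonneg) auto

lemma fibre_size_sh:
  assumes "insert j K \<subseteq> {1..n}" "P \<subseteq> {1..n}"
  shows "fibre_size n j K (sh n P) = fibre_size n j K P"
proof -
  have "fibre_size n j K (sh n P) = (\<Sum>A\<in>Pow {1..n}. signed_count n j K (sh n A) (sh n P))"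
    unfolding fibre_size_def by (rule sum.reindex_bij_betw[OF bij_betw_sh, symmetric])
  then show ?thesis
    unfolding fibre_size_def using signed_count_sh[OF assms(1) _ assms(2)] by simp
qed

lemma fibre_size_Escher:
  assumes j: "j \<in> {1..n - 1}" and P: "P = {} \<or> P = {1..n}"
  shows "fibre_size n j K P = 0"
proof -
  have "{\<pi> \<in> inverse_descent_class n (Pow (insert j L)). cyclic_word_descents n (insert j L) \<pi> = P} = {}" for L
    using cyclic_word_descents_proper[OF _ insertI1 j] P unfolding inverse_descent_class_def by blast
  then show ?thesis unfolding fibre_size_eq by (simp only: card.empty) simp
qed

lemma fibre_size_extension:
  assumes n: "1 \<le> n" and K: "finite K" and Q: "Q \<subseteq> {1..n - 1}"
  shows "fibre_size n j K Q + fibre_size n j K (insert n Q)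
    = int (card {\<pi>. \<pi> permutes {1..n} \<and> Des n (inv \<pi>) - {j} = K \<and> Des n \<pi> = Q})"
proof -
  let ?c = "\<lambda>L. cyclic_word_descents n (insert j L)"
  let ?U = "\<lambda>L. inverse_descent_class n (Pow (insert j L))"
  have nQ: "n \<notin> Q" using Q n by auto
  have *: "card {\<pi> \<in> ?U L. ?c L \<pi> = Q} + card {\<pi> \<in> ?U L. ?c L \<pi> = insert n Q}
      = card {\<pi> \<in> ?U L. Des n \<pi> = Q}" for L
  proof -
    have "?c L \<pi> = Q \<or> ?c L \<pi> = insert n Q \<longleftrightarrow> Des n \<pi> = Q" if U: "\<pi> \<in> ?U L" for \<pi>
    proof -
      have split: "x \<in> {1..n} \<Longrightarrow> x = n \<or> x \<in> {1..n - 1}" for x by auto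
      have "?c L \<pi> = ?c L \<pi> \<inter> {1..n - 1} \<or> ?c L \<pi> = insert n (?c L \<pi> \<inter> {1..n - 1})"
        using cyclic_word_descents_subset[of n "insert j L" \<pi>] split by blast
      moreover have "insert n Q \<inter> {1..n - 1} = Q" "Q \<inter> {1..n - 1} = Q" using Q n by auto
      ultimately show ?thesis using cyclic_word_descents_Int_eq_Des[OF U] by metis
    qed
    then have "{\<pi> \<in> ?U L. Des n \<pi> = Q} = {\<pi> \<in> ?U L. ?c L \<pi> = Q} \<union> {\<pi> \<in> ?U L. ?c L \<pi> = insert n Q}"
      by blast
    moreover have "{\<pi> \<in> ?U L. ?c L \<pi> = Q} \<inter> {\<pi> \<in> ?U L. ?c L \<pi> = insert n Q} = {}"
      using nQ by auto
    ultimately show ?thesis using finite_inverse_descent_class by (simp add: card_Un_disjoint)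
  qed
  show ?thesis
    unfolding fibre_size_eq inverse_descent_inclusion_exclusion[OF K, symmetric]
    by (simp only: sum.distrib[symmetric] distrib_left[symmetric] of_nat_add[symmetric] *)
qed

section \<open>Existence of cyclic descent extensions\<close>

text \<open>
  A cyclic descent extension is a matter of fibre sizes only.  If \<open>m P\<close> is the intended number of
  elements with cyclic descent set \<open>P\<close>, the equation \<open>m_ext\<close> allows \<open>n\<close> to be added to the descent
  set of \<open>m (insert n Q)\<close> arbitrarily chosen elements of each fibre of \<open>D\<close>, and invariance of \<open>m\<close>
  supplies bijections from each fibre to the shifted one, which together form \<open>p\<close>.
\<close>
lemma has_cyclic_descent_extension_of_fibre_sizes:
  assumes n: "1 \<le> n" and T: "finite T" and D: "\<And>t. t \<in> T \<Longrightarrow> D t \<subseteq> {1..n - 1}"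
    and m_sh: "\<And>P. P \<subseteq> {1..n} \<Longrightarrow> m (sh n P) = m P"
    and m_Escher: "m {} = 0" "m {1..n} = 0"
    and m_ext: "\<And>Q. Q \<subseteq> {1..n - 1} \<Longrightarrow> m Q + m (insert n Q) = card {t \<in> T. D t = Q}"
  shows "has_cyclic_descent_extension n T D"
proof -
  have "\<forall>Q\<in>Pow {1..n - 1}. \<exists>S. S \<subseteq> {t \<in> T. D t = Q} \<and> card S = m (insert n Q)"
  proof
    fix Q assume "Q \<in> Pow {1..n - 1}"
    then have "m (insert n Q) \<le> card {t \<in> T. D t = Q}" using m_ext[of Q] by simp
    from obtain_subset_with_card_n[OF this]
    show "\<exists>S. S \<subseteq> {t \<in> T. D t = Q} \<and> card S = m (insert n Q)" by metis
  qed
  from bchoice[OF this] obtain S where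
    S: "\<And>Q. Q \<subseteq> {1..n - 1} \<Longrightarrow> S Q \<subseteq> {t \<in> T. D t = Q}"
       "\<And>Q. Q \<subseteq> {1..n - 1} \<Longrightarrow> card (S Q) = m (insert n Q)" by blast
  define cDes where "cDes t = (if t \<in> S (D t) then insert n (D t) else D t)" for t
  define F where "F P = {t \<in> T. cDes t = P}" for P
  have finF: "finite (F P)" for P using T by (simp add: F_def)
  have nD: "n \<notin> D t" if "t \<in> T" for t using D[OF that] n by auto
  have sub: "cDes t \<subseteq> {1..n}" if "t \<in> T" for t
  proof -
    have "{1..n - 1} \<subseteq> {1..n}" "n \<in> {1..n}" using n by auto
    then show ?thesis using subset_trans[OF D[OF that]] unfolding cDes_def by simp
  qed
  have cardF: "card (F P) = m P" if P: "P \<subseteq> {1..n}" for P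
  proof -
    define Q where "Q = P - {n}"
    have Q: "Q \<subseteq> {1..n - 1}"
    proof
      fix x assume "x \<in> Q"
      then have "x \<in> {1..n}" "x \<noteq> n" using P by (auto simp: Q_def)
      then show "x \<in> {1..n - 1}" by auto
    qed
    then have nQ: "n \<notin> Q" using n by auto
    show ?thesis
    proof (cases "n \<in> P")
      case True
      then have PQ: "P = insert n Q" by (auto simp: Q_def)
      have "F P = S Q"
      proof (rule antisym; rule subsetI)
        fix t assume t: "t \<in> F P"
        then have tT: "t \<in> T" and c: "cDes t = insert n Q" by (auto simp: F_def PQ)
        then have "t \<in> S (D t)" "insert n (D t) = insert n Q"
          using nD[OF tT] by (auto simp: cDes_def split: if_splits)
        then show "t \<in> S Q" using nD[OF tT] nQ by (metis insert_ident)
      next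
        fix t assume "t \<in> S Q"
        then show "t \<in> F P" using S(1)[OF Q] by (auto simp: F_def PQ cDes_def)
      qed
      then show ?thesis using S(2)[OF Q] PQ by simp
    next
      case False
      then have PQ: "P = Q" by (auto simp: Q_def)
      have "F P = {t \<in> T. D t = Q} - S Q"
        using nQ by (auto simp: F_def PQ cDes_def)
      then have "card (F P) = card {t \<in> T. D t = Q} - card (S Q)"
        using S(1)[OF Q] T by (simp add: card_Diff_subset finite_subset)
      then show ?thesis using S(2)[OF Q] m_ext[OF Q] PQ by simp
    qed
  qed
  have "\<forall>P\<in>Pow {1..n}. \<exists>f. bij_betw f (F P) (F (sh n P))"
  proof
    fix P assume "P \<in> Pow {1..n}"
    then have "card (F P) = card (F (sh n P))" using cardF sh_subset m_sh by (metis PowD)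
    then show "\<exists>f. bij_betw f (F P) (F (sh n P))" by (rule finite_same_card_bij[OF finF finF])
  qed
  from bchoice[OF this] obtain f where
    f: "\<And>P. P \<subseteq> {1..n} \<Longrightarrow> bij_betw (f P) (F P) (F (sh n P))" by blast
  define p where "p t = f (cDes t) t" for t
  have pF: "p t \<in> F (sh n (cDes t))" if "t \<in> T" for t
    using bij_betwE[OF f[OF sub[OF that]]] that unfolding p_def F_def by blast
  have "inj_on p T"
  proof (rule inj_onI)
    fix s t assume st: "s \<in> T" "t \<in> T" and eq: "p s = p t"
    have "sh n (cDes s) = sh n (cDes t)" using pF[OF st(1)] pF[OF st(2)] eq by (simp add: F_def)
    then have c: "cDes s = cDes t" using sh_eq_iff[OF sub sub] st by blast
    then have "s \<in> F (cDes t)" "t \<in> F (cDes t)" "f (cDes t) s = f (cDes t) t"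
      using st eq by (auto simp: F_def p_def)
    then show "s = t" using bij_betw_imp_inj_on[OF f[OF sub[OF st(2)]]] by (auto dest: inj_onD)
  qed
  moreover have "p ` T \<subseteq> T" using pF by (auto simp: F_def)
  ultimately have "bij_betw p T T" using T by (simp add: bij_betw_def endo_inj_surj)
  moreover have "cDes t \<inter> {1..n - 1} = D t" if "t \<in> T" for t
  proof -
    have "n \<notin> {1..n - 1}" using n by auto
    then show ?thesis using D[OF that] unfolding cDes_def by auto
  qed
  moreover have "cDes (p t) = sh n (cDes t)" if "t \<in> T" for t
    using pF[OF that] by (simp add: F_def)
  moreover have "cDes t \<noteq> {}" "cDes t \<noteq> {1..n}" if "t \<in> T" for t
  proof -
    have "card (F (cDes t)) \<noteq> 0" using that finF by (auto simp: F_def)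
    then show "cDes t \<noteq> {}" "cDes t \<noteq> {1..n}"
      using cardF[OF sub[OF that]] m_Escher by metis+
  qed
  ultimately have "is_cyclic_descent_extension n T D cDes p"
    unfolding is_cyclic_descent_extension_def psubset_eq using sub by blast
  then show ?thesis unfolding has_cyclic_descent_extension_def by blast
qed

text \<open>
  Extensions of the parts of a partition combine to one of the whole; the parts are the fibres
  of \<open>\<phi>\<close>.
\<close>
lemma has_cyclic_descent_extension_glue:
  assumes "\<And>x. x \<in> \<phi> ` T \<Longrightarrow> has_cyclic_descent_extension n {t \<in> T. \<phi> t = x} D"
  shows "has_cyclic_descent_extension n T D"
proof -
  have "\<forall>x\<in>\<phi> ` T. \<exists>cp. is_cyclic_descent_extension n {t \<in> T. \<phi> t = x} D (fst cp) (snd cp)"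
    using assms unfolding has_cyclic_descent_extension_def by simp
  from bchoice[OF this] obtain cp where
    cp: "\<And>t. t \<in> T \<Longrightarrow>
      is_cyclic_descent_extension n {s \<in> T. \<phi> s = \<phi> t} D (fst (cp (\<phi> t))) (snd (cp (\<phi> t)))"
    by blast
  define cDes where "cDes t = fst (cp (\<phi> t)) t" for t
  define p where "p t = snd (cp (\<phi> t)) t" for t
  have bij: "bij_betw (snd (cp (\<phi> t))) {s \<in> T. \<phi> s = \<phi> t} {s \<in> T. \<phi> s = \<phi> t}" if "t \<in> T" for t
    using cp[OF that] unfolding is_cyclic_descent_extension_def by blast
  have pT: "p t \<in> T" and \<phi>p: "\<phi> (p t) = \<phi> t" if "t \<in> T" for t
    using bij_betwE[OF bij[OF that]] that unfolding p_def by auto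
  have "inj_on p T"
  proof (rule inj_onI)
    fix s t assume st: "s \<in> T" "t \<in> T" and eq: "p s = p t"
    then have \<phi>: "\<phi> s = \<phi> t" using \<phi>p by metis
    then have "snd (cp (\<phi> t)) s = snd (cp (\<phi> t)) t" using eq by (simp add: p_def)
    then show "s = t" using bij_betw_imp_inj_on[OF bij[OF st(2)]] st \<phi> by (auto dest: inj_onD)
  qed
  moreover have "T \<subseteq> p ` T"
  proof
    fix t assume t: "t \<in> T"
    then have "t \<in> snd (cp (\<phi> t)) ` {s \<in> T. \<phi> s = \<phi> t}"
      using bij_betw_imp_surj_on[OF bij[OF t]] by simp
    then obtain s where s: "s \<in> T" "\<phi> s = \<phi> t" "t = snd (cp (\<phi> t)) s" by blast
    then have "t = p s" by (simp add: p_def)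
    then show "t \<in> p ` T" using s(1) by (rule image_eqI)
  qed
  ultimately have "bij_betw p T T" using pT by (auto simp: bij_betw_def)
  moreover have "cDes t \<subseteq> {1..n} \<and> cDes t \<inter> {1..n - 1} = D t \<and> cDes (p t) = sh n (cDes t)
      \<and> {} \<subset> cDes t \<and> cDes t \<subset> {1..n}" if "t \<in> T" for t
  proof -
    have "t \<in> {s \<in> T. \<phi> s = \<phi> t}" using that by simp
    with cp[OF that] show ?thesis
      unfolding is_cyclic_descent_extension_def cDes_def \<phi>p[OF that] unfolding p_def by blast
  qed
  ultimately have "is_cyclic_descent_extension n T D cDes p"
    unfolding is_cyclic_descent_extension_def by blast
  then show ?thesis unfolding has_cyclic_descent_extension_def by blast
qed

text \<open>
  The covering relations of the Boolean lattice are the smallest families with an extension; the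
  larger ones in the theorem are partitioned into them.
\<close>
lemma edge_has_cyclic_descent_extension:
  assumes j: "j \<in> {1..n - 1}" and K: "K \<subseteq> {1..n - 1}" and jK: "j \<notin> K"
  shows "has_cyclic_descent_extension n (inverse_descent_class n {K, insert j K}) (Des n)"
proof (rule has_cyclic_descent_extension_of_fibre_sizes[where m = "\<lambda>P. nat (fibre_size n j K P)"])
  show n: "1 \<le> n" using j by auto
  have jn: "{1..n - 1} \<subseteq> {1..n}" by auto
  then have Kn: "K \<subseteq> {1..n}" and jKn: "insert j K \<subseteq> {1..n}" using j K by blast+
  have fK: "finite K" by (rule finite_subset[OF K]) simp
  show "finite (inverse_descent_class n {K, insert j K})" by (rule finite_inverse_descent_class)
  show "Des n \<pi> \<subseteq> {1..n - 1}" for \<pi> by (rule Des_subset)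
  show "nat (fibre_size n j K (sh n P)) = nat (fibre_size n j K P)" if "P \<subseteq> {1..n}" for P
    using fibre_size_sh[OF jKn that] by simp
  show "nat (fibre_size n j K {}) = 0" "nat (fibre_size n j K {1..n}) = 0"
    using fibre_size_Escher[OF j] by simp_all
  fix Q assume Q: "Q \<subseteq> {1..n - 1}"
  have Qn: "Q \<subseteq> {1..n}" "insert n Q \<subseteq> {1..n}" using subset_trans[OF Q jn] n by simp_all
  have "{\<pi> \<in> inverse_descent_class n {K, insert j K}. Des n \<pi> = Q}
      = {\<pi>. \<pi> permutes {1..n} \<and> Des n (inv \<pi>) - {j} = K \<and> Des n \<pi> = Q}"
  proof -
    have "X \<in> {K, insert j K} \<longleftrightarrow> X - {j} = K" for X using jK by auto
    then show ?thesis unfolding inverse_descent_class_def by blast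
  qed
  then show "nat (fibre_size n j K Q) + nat (fibre_size n j K (insert n Q))
      = card {\<pi> \<in> inverse_descent_class n {K, insert j K}. Des n \<pi> = Q}"
    using fibre_size_extension[OF n fK Q, of j] fibre_size_nonneg[OF j Kn] Qn
    by (simp add: nat_add_distrib[symmetric])
qed

text \<open>
  The function \<open>\<phi>\<close> encodes a perfect matching of \<open>\<J>\<close> by covering relations: its fibres on \<open>\<J>\<close> are the
  matched pairs.
\<close>
lemma matched_family_has_cyclic_descent_extension:
  assumes edge: "\<And>K. K \<in> \<J> \<Longrightarrow> \<exists>j L. j \<in> {1..n - 1} \<and> L \<subseteq> {1..n - 1} \<and> j \<notin> L
     \<and> {K' \<in> \<J>. \<phi> K' = \<phi> K} = {L, insert j L}"
  shows "has_cyclic_descent_extension n (inverse_descent_class n \<J>) (Des n)"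
proof (rule has_cyclic_descent_extension_glue[where \<phi> = "\<lambda>\<pi>. \<phi> (Des n (inv \<pi>))"])
  fix x assume "x \<in> (\<lambda>\<pi>. \<phi> (Des n (inv \<pi>))) ` inverse_descent_class n \<J>"
  then obtain K where K: "K \<in> \<J>" "x = \<phi> K" by (auto simp: inverse_descent_class_def)
  obtain j L where jL: "j \<in> {1..n - 1}" "L \<subseteq> {1..n - 1}" "j \<notin> L"
    and eq: "{K' \<in> \<J>. \<phi> K' = \<phi> K} = {L, insert j L}"
    using edge[OF K(1)] by blast
  have "{\<pi> \<in> inverse_descent_class n \<J>. \<phi> (Des n (inv \<pi>)) = x} = inverse_descent_class n {K' \<in> \<J>. \<phi> K' = x}"
    by (auto simp: inverse_descent_class_def)
  then show "has_cyclic_descent_extension n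
      {\<pi> \<in> inverse_descent_class n \<J>. \<phi> (Des n (inv \<pi>)) = x} (Des n)"
    using edge_has_cyclic_descent_extension[OF jL] eq K(2) by simp
qed

section \<open>A parity obstruction\<close>

lemma sh_insert_initial:
  assumes "k < n"
  shows "sh n (insert n {1..k}) = {1..Suc k}"
proof -
  have "sh n (insert n {1..k}) = insert (rot n n) (rot n ` {1..k})"
    using assms by (subst sh_eq_rot_image) auto
  also have "rot n ` {1..k} = Suc ` {1..k}"
    using assms by (intro image_cong) (auto simp: rot_simps)
  also have "rot n n = 1" using assms by (intro rot_simps) simp
  also have "insert 1 (Suc ` {1..k}) = {1..Suc k}"
    by (simp only: image_Suc_atLeastAtMost) auto
  finally show ?thesis .
qed

text \<open>
  If \<open>D t = {1..k}\<close>, then the cyclic descent set of \<open>t\<close> is \<open>{1..k}\<close> or \<open>insert n {1..k}\<close>, and the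
  shift sends the latter to \<open>{1..Suc k}\<close>.  The excluded sets \<open>{}\<close> and \<open>{1..n}\<close> are just the ones for
  which this pairing would run out of range, so \<open>p\<close> matches the elements whose cyclic
  descent set contains \<open>n\<close> with the others.
\<close>
lemma even_card_initial_descent_sets:
  assumes n: "1 \<le> n" and T: "finite T" and cde: "has_cyclic_descent_extension n T D"
  shows "even (card {t \<in> T. \<exists>k\<le>n - 1. D t = {1..k}})"
proof -
  from cde obtain cDes p where "is_cyclic_descent_extension n T D cDes p"
    unfolding has_cyclic_descent_extension_def by blast
  note ext_def = this[unfolded is_cyclic_descent_extension_def]
  have p: "bij_betw p T T" using ext_def by blast
  have sub: "cDes t \<subseteq> {1..n}" and ext: "cDes t \<inter> {1..n - 1} = D t"
    and equi: "cDes (p t) = sh n (cDes t)" and proper: "cDes t \<noteq> {} \<and> cDes t \<noteq> {1..n}"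
    if "t \<in> T" for t
    using ext_def that by blast+
  let ?E = "{t \<in> T. \<exists>k\<le>n - 1. D t = {1..k}}"
  define A where "A = {t \<in> ?E. n \<in> cDes t}"
  define B where "B = {t \<in> ?E. n \<notin> cDes t}"
  have split: "x = n \<or> x \<in> {1..n - 1}" if "x \<in> {1..n}" for x using that by auto
  have withn: "cDes t = insert n (D t)" if "t \<in> T" "n \<in> cDes t" for t
    using split sub[OF that(1)] ext[OF that(1)] that(2) by blast
  have withoutn: "cDes t = D t" if "t \<in> T" "n \<notin> cDes t" for t
    using split sub[OF that(1)] ext[OF that(1)] that(2) by blast
  have "p ` A \<subseteq> B"
  proof (rule image_subsetI)
    fix t assume "t \<in> A"
    then obtain k where t: "t \<in> T" "n \<in> cDes t" "D t = {1..k}" "k \<le> n - 1" by (auto simp: A_def)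
    have c: "cDes t = insert n {1..k}" using withn[OF t(1,2)] t(3) by simp
    have "k \<noteq> n - 1"
    proof
      assume "k = n - 1"
      then have "cDes t = {1..n}" unfolding c using n by auto
      then show False using proper[OF t(1)] by blast
    qed
    then have k: "Suc k \<le> n - 1" using t(4) by simp
    have "cDes (p t) = {1..Suc k}" using equi[OF t(1)] c sh_insert_initial[of k n] k by simp
    moreover have pt: "p t \<in> T" using p t(1) by (rule bij_betw_apply)
    moreover have "{1..Suc k} \<inter> {1..n - 1} = {1..Suc k}" using k by auto
    moreover have "n \<notin> {1..Suc k}" using k by auto
    ultimately have "D (p t) = {1..Suc k}" "n \<notin> cDes (p t)" using ext[OF pt] by metis+
    then show "p t \<in> B" using pt k unfolding B_def by blast
  qed
  moreover have "B \<subseteq> p ` A"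
  proof
    fix t assume "t \<in> B"
    then obtain k where t: "t \<in> T" "n \<notin> cDes t" "D t = {1..k}" "k \<le> n - 1" by (auto simp: B_def)
    have c: "cDes t = {1..k}" using withoutn[OF t(1,2)] t(3) by simp
    then have k: "1 \<le> k" using proper[OF t(1)] by (cases k) auto
    obtain s where s: "s \<in> T" "t = p s" using p t(1) by (auto simp: bij_betw_def)
    let ?P = "insert n {1..k - 1}"
    have P: "?P \<subseteq> {1..n}" using n t(4) by auto
    have "sh n (cDes s) = sh n ?P"
      using equi[OF s(1)] s(2) c sh_insert_initial[of "k - 1" n] k t(4) by simp
    then have cs: "cDes s = ?P" using sh_eq_iff[OF sub[OF s(1)] P] by simp
    have "?P \<inter> {1..n - 1} = {1..k - 1}" using n t(4) by auto
    then have "D s = {1..k - 1}" using ext[OF s(1)] cs by simp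
    moreover have "k - 1 \<le> n - 1" using t(4) by simp
    ultimately have "s \<in> A" using s(1) cs unfolding A_def by blast
    then show "t \<in> p ` A" using s(2) by blast
  qed
  moreover have "inj_on p A"
    by (rule inj_on_subset[OF bij_betw_imp_inj_on[OF p]]) (auto simp: A_def)
  ultimately have AB: "card A = card B" by (metis card_image subset_antisym)
  have "?E = A \<union> B" "A \<inter> B = {}" by (auto simp: A_def B_def)
  moreover have "finite A" "finite B" using T by (auto simp: A_def B_def)
  ultimately have "card ?E = card A + card B" by (simp only: card_Un_disjoint)
  then show ?thesis using AB by simp
qed

text \<open>
  A permutation with descent set \<open>{1..k}\<close> decreases to the value 1 and increases afterwards.  It is
  determined by the values to the left of 1, and \<open>v\<close> is one of them exactly if \<open>v - 1\<close> is a descent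
  of the inverse.  This key lists these values in decreasing order, then the others increasingly.
\<close>
definition valley_key :: "nat set \<Rightarrow> nat \<Rightarrow> int" where
  "valley_key K v = (if v - 1 \<in> K then - int v else int v)"

lemma exists_valley_permutation:
  assumes K: "K \<subseteq> {1..n - 1}" and n: "1 \<le> n"
  shows "\<exists>\<pi>. \<pi> permutes {1..n} \<and> Des n (inv \<pi>) = K \<and> (\<exists>k\<le>n - 1. Des n \<pi> = {1..k})"
proof -
  define \<tau> where "\<tau> = rank_map n (valley_key K)"
  let ?\<pi> = "inv \<tau>"
  have \<tau>: "\<tau> permutes {1..n}"
    unfolding \<tau>_def by (rule rank_map_permutes) (auto simp: inj_on_def valley_key_def split: if_splits)
  have p: "?\<pi> permutes {1..n}" by (rule permutes_inv[OF \<tau>])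
  have inv: "inv ?\<pi> = \<tau>" using permutes_bij[OF \<tau>] by (rule inv_inv_eq)
  have less: "\<tau> u < \<tau> v \<longleftrightarrow> valley_key K u < valley_key K v" if "u \<in> {1..n}" "v \<in> {1..n}" for u v
    using rank_map_le_iff[OF that(2,1), of "valley_key K"] by (simp add: \<tau>_def not_le[symmetric])
  have "v \<in> Des n \<tau> \<longleftrightarrow> v \<in> K" if v: "v \<in> {1..n - 1}" for v
  proof -
    have "v \<in> Des n \<tau> \<longleftrightarrow> \<tau> (v + 1) < \<tau> v" using v by (simp add: Des_def)
    also have "\<dots> \<longleftrightarrow> valley_key K (v + 1) < valley_key K v" using v by (intro less) auto
    also have "\<dots> \<longleftrightarrow> v \<in> K" using v by (auto simp: valley_key_def)
    finally show ?thesis .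
  qed
  then have DK: "Des n \<tau> = K" using Des_subset[of n \<tau>] K by blast
  have 1: "1 \<in> {1..n}" using n by simp
  have key1: "valley_key K 1 = 1" using K by (auto simp: valley_key_def)
  have iff: "?\<pi> (i + 1) < ?\<pi> i \<longleftrightarrow> i \<le> \<tau> 1 - 1" if i: "i \<in> {1..n - 1}" for i
  proof -
    define v w where "v = ?\<pi> i" and "w = ?\<pi> (i + 1)"
    have vw: "v \<in> {1..n}" "w \<in> {1..n}"
      unfolding v_def w_def by (rule permutes_inv_in[OF \<tau>], use i in force)+
    have \<tau>v: "\<tau> v = i" "\<tau> w = i + 1"
      unfolding v_def w_def using permutes_inverses(1)[OF \<tau>] by auto
    then have key: "valley_key K v < valley_key K w" using less[OF vw] by simp
    have "v \<noteq> w" using key by auto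
    \<comment> \<open>The value 1 does not lie strictly between neighbours in the order by keys.\<close>
    have "\<not> (\<tau> v < \<tau> 1 \<and> \<tau> 1 < \<tau> w)" using \<tau>v by simp
    then have no: "\<not> (valley_key K v < 1 \<and> 1 < valley_key K w)"
      using less[OF vw(1) 1] less[OF 1 vw(2)] key1 by simp
    \<comment> \<open>\<open>v\<close> and \<open>w\<close> are consecutive in the order by keys and the value 1 has key 1.  So either the
        key of \<open>w\<close> is at most 1 and the values go down to 1, or they go up from there.\<close>
    have "w < v \<longleftrightarrow> \<not> 1 < valley_key K w"
      using key no vw \<open>v \<noteq> w\<close> by (auto simp: valley_key_def split: if_splits)
    also have "\<dots> \<longleftrightarrow> \<not> \<tau> 1 < \<tau> w" using less[OF 1 vw(2)] key1 by simp
    also have "\<dots> \<longleftrightarrow> i \<le> \<tau> 1 - 1" using i \<tau>v by auto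
    finally show ?thesis unfolding v_def w_def .
  qed
  have \<tau>1: "\<tau> 1 - 1 \<le> n - 1" using permutes_in_image[OF \<tau>, of 1] 1 by auto
  have "Des n ?\<pi> = {1..\<tau> 1 - 1}"
  proof (rule set_eqI)
    fix i
    show "i \<in> Des n ?\<pi> \<longleftrightarrow> i \<in> {1..\<tau> 1 - 1}"
      using iff[of i] \<tau>1 by (cases "i \<in> {1..n - 1}") (simp_all add: Des_def, linarith)
  qed
  then show ?thesis using p inv DK \<tau>1 by metis
qed

lemma valley_permutation_unique:
  assumes p: "\<pi> permutes {1..n}" and K: "Des n (inv \<pi>) = K"
    and k: "k \<le> n - 1" and D: "Des n \<pi> = {1..k}"
  shows "inv \<pi> = rank_map n (valley_key K)"
proof -
  have inj: "\<pi> a \<noteq> \<pi> b" if "a \<noteq> b" for a b using permutes_inj[OF p] that by (auto dest: injD)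
  have inn: "\<pi> a \<in> {1..n}" if "a \<in> {1..n}" for a using permutes_in_image[OF p] that by blast
  have down: "\<pi> b < \<pi> a" if "1 \<le> a" "a < b" "b \<le> k + 1" for a b
  proof -
    have "- int (\<pi> a) < - int (\<pi> b)"
    proof (rule less_of_adjacent_less[OF _ that(2)])
      fix i assume "a \<le> i" "i < b"
      then have "i \<in> Des n \<pi>" using that D by simp
      then show "- int (\<pi> i) < - int (\<pi> (Suc i))" by (simp add: Des_def)
    qed
    then show ?thesis by simp
  qed
  have up: "\<pi> a < \<pi> b" if "k + 1 \<le> a" "a < b" "b \<le> n" for a b
  proof (rule less_of_adjacent_less[OF _ that(2)])
    fix i assume i: "a \<le> i" "i < b"
    then have "i \<notin> Des n \<pi>" "i \<in> {1..n - 1}" using that D by auto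
    then show "\<pi> i < \<pi> (Suc i)" using inj[of i "Suc i"] by (auto simp: Des_def)
  qed
  have step: "valley_key K (\<pi> i) < valley_key K (\<pi> (Suc i))" if i: "i \<in> {1..n - 1}" for i
  proof (cases "i \<le> k")
    case True
    \<comment> \<open>The value \<open>\<pi> i - 1\<close> can only lie to the right of \<open>i\<close>, since \<open>\<pi>\<close> decreases up to \<open>i\<close>.\<close>
    define w where "w = \<pi> i - 1"
    have lt: "\<pi> (Suc i) < \<pi> i" using True i by (intro down) auto
    have "\<pi> i \<in> {1..n}" "\<pi> (Suc i) \<in> {1..n}" by (rule inn, use i in force)+
    then have w: "w \<in> {1..n - 1}" "w \<in> {1..n}" "w + 1 = \<pi> i" using lt by (auto simp: w_def)
    have q: "inv \<pi> w \<in> {1..n}" "\<pi> (inv \<pi> w) = w"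
      using permutes_inv_in[OF p w(2)] permutes_inverses(1)[OF p] by auto
    have "inv \<pi> w \<noteq> i" using q(2) w(3) by auto
    moreover have "\<not> inv \<pi> w < i" using down[of "inv \<pi> w" i] q True w(3) by auto
    ultimately have "inv \<pi> (w + 1) < inv \<pi> w"
      using permutes_inverses(2)[OF p] w(3) by simp
    then have "w \<in> K" using K w(1) by (auto simp: Des_def)
    then have "valley_key K (\<pi> i) = - int (\<pi> i)" by (simp add: valley_key_def w_def)
    then show ?thesis using lt by (simp add: valley_key_def)
  next
    case False
    \<comment> \<open>The value \<open>\<pi> (Suc i) - 1\<close> can only lie to the left, since \<open>\<pi>\<close> increases from \<open>Suc i\<close> on.\<close>
    define w where "w = \<pi> (Suc i) - 1"
    have lt: "\<pi> i < \<pi> (Suc i)" using False i by (intro up) auto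
    have "\<pi> i \<in> {1..n}" "\<pi> (Suc i) \<in> {1..n}" by (rule inn, use i in force)+
    then have w: "w \<in> {1..n}" "w + 1 = \<pi> (Suc i)" using lt by (auto simp: w_def)
    have q: "inv \<pi> w \<in> {1..n}" "\<pi> (inv \<pi> w) = w"
      using permutes_inv_in[OF p w(1)] permutes_inverses(1)[OF p] by auto
    have "\<not> Suc i < inv \<pi> w" using up[of "Suc i" "inv \<pi> w"] q False w(2) by auto
    then have "\<not> inv \<pi> (w + 1) < inv \<pi> w"
      using permutes_inverses(2)[OF p] w(2) by simp
    then have "w \<notin> K" using K by (auto simp: Des_def)
    then have "valley_key K (\<pi> (Suc i)) = int (\<pi> (Suc i))" by (simp add: valley_key_def w_def)
    then show ?thesis using lt by (simp add: valley_key_def)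
  qed
  show ?thesis
  proof (rule eq_rank_map[OF permutes_inv[OF p]])
    fix u v assume uv: "u \<in> {1..n}" "v \<in> {1..n}" "inv \<pi> u < inv \<pi> v"
    have "inv \<pi> u \<in> {1..n}" "inv \<pi> v \<in> {1..n}" using permutes_inv_in[OF p] uv by blast+
    then have "valley_key K (\<pi> (inv \<pi> u)) < valley_key K (\<pi> (inv \<pi> v))"
      by (intro less_of_adjacent_less[OF _ uv(3), of "\<lambda>i. valley_key K (\<pi> i)"] step) auto
    then show "valley_key K u < valley_key K v" using permutes_inverses(1)[OF p] by simp
  qed
qed

text \<open>
  Each set of \<open>\<J>\<close> is the inverse descent set of exactly one permutation whose descent set is an
  initial segment, so the even number found above is \<open>card \<J>\<close>.
\<close>
lemma even_card_of_cyclic_descent_extension: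
  assumes n: "1 \<le> n" and J: "\<J> \<subseteq> Pow {1..n - 1}"
    and cde: "has_cyclic_descent_extension n (inverse_descent_class n \<J>) (Des n)"
  shows "even (card \<J>)"
proof -
  let ?E = "{\<pi> \<in> inverse_descent_class n \<J>. \<exists>k\<le>n - 1. Des n \<pi> = {1..k}}"
  have "bij_betw (\<lambda>\<pi>. Des n (inv \<pi>)) ?E \<J>"
  proof (rule bij_betw_imageI)
    show "inj_on (\<lambda>\<pi>. Des n (inv \<pi>)) ?E"
    proof (rule inj_onI)
      fix \<pi> \<sigma> assume "\<pi> \<in> ?E" "\<sigma> \<in> ?E" and eq: "Des n (inv \<pi>) = Des n (inv \<sigma>)"
      then have p: "\<pi> permutes {1..n}" "\<sigma> permutes {1..n}"
        and k: "\<exists>k\<le>n - 1. Des n \<pi> = {1..k}" "\<exists>k\<le>n - 1. Des n \<sigma> = {1..k}"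
        by (auto simp: inverse_descent_class_def)
      have "inv \<pi> = inv \<sigma>"
        using valley_permutation_unique[OF p(1) eq] valley_permutation_unique[OF p(2) refl] k by metis
      then show "\<pi> = \<sigma>" using inv_inv_eq permutes_bij p by metis
    qed
    show "(\<lambda>\<pi>. Des n (inv \<pi>)) ` ?E = \<J>"
    proof (rule antisym; rule subsetI)
      fix K assume K: "K \<in> \<J>"
      then obtain \<pi> where "\<pi> permutes {1..n}" "Des n (inv \<pi>) = K" "\<exists>k\<le>n - 1. Des n \<pi> = {1..k}"
        using exists_valley_permutation[OF _ n, of K] J by blast
      then show "K \<in> (\<lambda>\<pi>. Des n (inv \<pi>)) ` ?E"
        using K by (auto simp: inverse_descent_class_def)
    qed (auto simp: inverse_descent_class_def)
  qed
  then have "card ?E = card \<J>" by (rule bij_betw_same_card)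
  then show ?thesis
    using even_card_initial_descent_sets[OF n finite_inverse_descent_class cde] by simp
qed

section \<open>Intervals and maximal chains\<close>

lemma interval_has_cyclic_descent_extension_iff:
  assumes n: "1 \<le> n" and IJ: "I \<subseteq> J" and J: "J \<subseteq> {1..n - 1}"
  shows "has_cyclic_descent_extension n (inverse_descent_class n {I..J}) (Des n) \<longleftrightarrow> I \<subset> J"
proof
  assume "I \<subset> J"
  then obtain j where j: "j \<in> J" "j \<notin> I" by blast
  show "has_cyclic_descent_extension n (inverse_descent_class n {I..J}) (Des n)"
  proof (rule matched_family_has_cyclic_descent_extension[where \<phi> = "\<lambda>K. K - {j}"])
    fix K assume K: "K \<in> {I..J}"
    have "{K' \<in> {I..J}. K' - {j} = K - {j}} = {K - {j}, insert j (K - {j})}"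
    proof (rule antisym; rule subsetI)
      fix X assume "X \<in> {K' \<in> {I..J}. K' - {j} = K - {j}}"
      then have "X - {j} = K - {j}" by simp
      then show "X \<in> {K - {j}, insert j (K - {j})}" by (cases "j \<in> X") auto
    qed (use K j in auto)
    moreover have "j \<in> {1..n - 1}" "K - {j} \<subseteq> {1..n - 1}" using j K J by auto
    ultimately show "\<exists>i L. i \<in> {1..n - 1} \<and> L \<subseteq> {1..n - 1} \<and> i \<notin> L \<and>
        {K' \<in> {I..J}. K' - {j} = K - {j}} = {L, insert i L}" by blast
  qed
next
  assume cde: "has_cyclic_descent_extension n (inverse_descent_class n {I..J}) (Des n)"
  have "{I..J} \<subseteq> Pow {1..n - 1}"
    using subset_trans[OF _ J] by (meson PowI atLeastAtMost_iff subsetI)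
  \<comment> \<open>For \<open>I = J\<close> the family has one member, an odd number.\<close>
  then have "even (card {I..J})" by (rule even_card_of_cyclic_descent_extension[OF n _ cde])
  then have "I \<noteq> J" by auto
  then show "I \<subset> J" using IJ by blast
qed

text \<open>
  A maximal chain contains exactly one set of each size in range: if size \<open>k\<close> were missing, the largest
  member below size \<open>k\<close> could be enlarged by an element of the smallest member above size \<open>k\<close>, and the
  result, of size at most \<open>k\<close>, would be comparable to the whole chain and hence belong to it.
\<close>
lemma maxchain_interval_bij_card:
  assumes IJ: "I \<subseteq> J" and J: "finite J" and C: "subset.maxchain {I..J} C"
  shows "bij_betw card C {card I..card J}"
proof -
  have sub: "C \<subseteq> {I..J}" and comp: "\<And>X Y. X \<in> C \<Longrightarrow> Y \<in> C \<Longrightarrow> X \<subseteq> Y \<or> Y \<subseteq> X"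
    using C unfolding subset.maxchain_def subset_chain_def by blast+
  have subI: "I \<subseteq> X" and subJ: "X \<subseteq> J" if "X \<in> C" for X
    using subsetD[OF sub that] by simp_all
  have max: "Z \<in> C" if Z: "I \<subseteq> Z" "Z \<subseteq> J" and cZ: "\<And>X. X \<in> C \<Longrightarrow> X \<subseteq> Z \<or> Z \<subseteq> X" for Z
  proof (rule ccontr)
    assume "Z \<notin> C"
    then have "C \<subset> insert Z C" by blast
    moreover have "subset.chain {I..J} (insert Z C)"
      unfolding subset_chain_def
    proof
      show "insert Z C \<subseteq> {I..J}" using Z sub by simp
      show "\<forall>X\<in>insert Z C. \<forall>Y\<in>insert Z C. X \<subseteq> Y \<or> Y \<subseteq> X" using cZ comp by blast
    qed
    ultimately show False using C unfolding subset.maxchain_def by blast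
  qed
  have fin: "finite X" if "X \<in> C" for X by (rule finite_subset[OF subJ[OF that] J])
  have finC: "finite C" by (rule finite_subset[of _ "Pow J"]) (use subJ J in auto)
  have mono: "X \<subseteq> Y" if "X \<in> C" "Y \<in> C" "card X \<le> card Y" for X Y
    using comp[OF that(1,2)] card_seteq[OF fin[OF that(1)] _ that(3)] by blast
  have IC: "I \<in> C" by (rule max[OF order_refl IJ]) (use subI in blast)
  have JC: "J \<in> C" by (rule max[OF IJ order_refl]) (use subJ in blast)
  have "inj_on card C" using mono by (intro inj_onI) (metis order_refl subset_antisym)
  moreover have "card ` C \<subseteq> {card I..card J}"
    using card_mono[OF fin subI] card_mono[OF J subJ] by auto
  moreover have "{card I..card J} \<subseteq> card ` C"
  proof
    fix k assume k: "k \<in> {card I..card J}"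
    show "k \<in> card ` C"
    proof (rule ccontr)
      assume no: "k \<notin> card ` C"
      let ?lo = "{X \<in> C. card X < k}" and ?hi = "{X \<in> C. k < card X}"
      have "card I \<noteq> k" "card J \<noteq> k" using IC JC no by auto
      then have "I \<in> ?lo" "J \<in> ?hi" using IC JC k by auto
      then have ne: "?lo \<noteq> {}" "?hi \<noteq> {}" by blast+
      have finlh: "finite ?lo" "finite ?hi" using finC by simp_all
      obtain X where X: "X \<in> ?lo" "Max (card ` ?lo) = card X"
        by (rule obtains_MAX[OF finlh(1) ne(1)])
      obtain Y where Y: "Y \<in> ?hi" "Min (card ` ?hi) = card Y"
        by (rule obtains_MIN[OF finlh(2) ne(2)])
      have Xmax: "card Z \<le> card X" if "Z \<in> ?lo" for Z
        unfolding X(2)[symmetric] using finlh(1) that by (intro Max_ge finite_imageI imageI)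
      have Ymin: "card Y \<le> card Z" if "Z \<in> ?hi" for Z
        unfolding Y(2)[symmetric] using finlh(2) that by (intro Min_le finite_imageI imageI)
      have "\<not> Y \<subseteq> X" using card_mono[of X Y] fin X(1) Y(1) by auto
      then have XY: "X \<subseteq> Y" using comp X(1) Y(1) by blast
      obtain y where y: "y \<in> Y" "y \<notin> X" using \<open>\<not> Y \<subseteq> X\<close> by blast
      \<comment> \<open>\<open>X\<close> is the largest member below size \<open>k\<close> and \<open>Y\<close> the smallest one above it.\<close>
      have "insert y X \<in> C"
      proof (rule max)
        show "I \<subseteq> insert y X" using subI X(1) by blast
        show "insert y X \<subseteq> J" using subJ X(1) Y(1) y(1) by blast
        fix Z assume Z: "Z \<in> C"
        then have "card Z \<noteq> k" using no by auto
        then consider "Z \<in> ?lo" | "Z \<in> ?hi" using Z by fastforce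
        then show "Z \<subseteq> insert y X \<or> insert y X \<subseteq> Z"
        proof cases
          case 1
          then show ?thesis using mono[OF Z _ Xmax[OF 1]] X(1) by blast
        next
          case 2
          then show ?thesis using mono[OF _ Z Ymin[OF 2]] Y(1) XY y by blast
        qed
      qed
      moreover from this have "card (insert y X) \<noteq> k" using no by blast
      moreover have "card (insert y X) = Suc (card X)" using y fin X(1) by simp
      ultimately show False using Xmax[of "insert y X"] X(1) by auto
    qed
  qed
  ultimately show ?thesis by (auto simp: bij_betw_def)
qed

text \<open>
  A maximal chain has \<open>card J - card I + 1\<close> members.  If this number is even, they are matched in
  consecutive pairs from the bottom.
\<close>
lemma maxchain_has_cyclic_descent_extension_iff:
  assumes n: "1 \<le> n" and IJ: "I \<subseteq> J" and J: "J \<subseteq> {1..n - 1}" and C: "subset.maxchain {I..J} C"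
  shows "has_cyclic_descent_extension n (inverse_descent_class n C) (Des n) \<longleftrightarrow> odd (card J - card I)"
proof -
  have fJ: "finite J" by (rule finite_subset[OF J]) simp
  have bij: "bij_betw card C {card I..card J}" by (rule maxchain_interval_bij_card[OF IJ fJ C])
  have sub: "C \<subseteq> {I..J}" and comp: "\<And>X Y. X \<in> C \<Longrightarrow> Y \<in> C \<Longrightarrow> X \<subseteq> Y \<or> Y \<subseteq> X"
    using C unfolding subset.maxchain_def subset_chain_def by blast+
  have le: "card I \<le> card J" by (rule card_mono[OF fJ IJ])
  have subJ: "X \<subseteq> J" if "X \<in> C" for X
    using subsetD[OF sub that] by simp_all
  have CP: "C \<subseteq> Pow {1..n - 1}" using subset_trans[OF subJ J] by blast
  have cardC: "card C = Suc (card J - card I)"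
    using bij_betw_same_card[OF bij] le by simp
  show ?thesis
  proof
    assume "has_cyclic_descent_extension n (inverse_descent_class n C) (Des n)"
    then have "even (card C)" by (rule even_card_of_cyclic_descent_extension[OF n CP])
    then show "odd (card J - card I)" using cardC by simp
  next
    assume odd: "odd (card J - card I)"
    \<comment> \<open>Members at heights \<open>2 i\<close> and \<open>2 i + 1\<close> above \<open>I\<close> are matched; \<open>r\<close> below is the size
        of the lower one.\<close>
    define \<phi> where "\<phi> X = (card X - card I) div 2" for X :: "nat set"
    show "has_cyclic_descent_extension n (inverse_descent_class n C) (Des n)"
    proof (rule matched_family_has_cyclic_descent_extension[where \<phi> = \<phi>])
      fix K assume K: "K \<in> C"
      have inC: "card X \<in> {card I..card J}" if "X \<in> C" for X using bij that by (rule bij_betw_apply)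
      define r where "r = card I + 2 * \<phi> K"
      have r: "card I \<le> r" "r + 1 \<le> card J"
      proof -
        have "2 * \<phi> K \<le> card K - card I" by (simp add: \<phi>_def)
        then have "2 * \<phi> K \<le> card J - card I" using inC[OF K] by auto
        moreover have "2 * \<phi> K \<noteq> card J - card I" using odd by presburger
        ultimately show "card I \<le> r" "r + 1 \<le> card J" unfolding r_def by auto
      qed
      have "r \<in> card ` C" "r + 1 \<in> card ` C"
        using bij_betw_imp_surj_on[OF bij] r by auto
      then obtain X Y where X: "X \<in> C" "card X = r" and Y: "Y \<in> C" "card Y = r + 1" by force
      have fin: "finite Z" if "Z \<in> C" for Z by (rule finite_subset[OF subJ[OF that] fJ])
      have "\<not> Y \<subseteq> X" using card_mono[OF fin[OF X(1)], of Y] X Y by auto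
      then have XY: "X \<subseteq> Y" using comp X Y by blast
      have "card (Y - X) = 1" using X Y fin XY by (simp add: card_Diff_subset)
      then obtain y where y: "Y - X = {y}" by (rule card_1_singletonE)
      then have YX: "Y = insert y X" "y \<notin> X" using XY by blast+
      have "{Z \<in> C. \<phi> Z = \<phi> K} = {X, Y}"
      proof (rule antisym; rule subsetI)
        fix Z assume "Z \<in> {Z \<in> C. \<phi> Z = \<phi> K}"
        then have Z: "Z \<in> C" "\<phi> Z = \<phi> K" by auto
        have "card Z - card I = 2 * \<phi> Z \<or> card Z - card I = 2 * \<phi> Z + 1"
          unfolding \<phi>_def by presburger
        then have "card Z = card X \<or> card Z = card Y"
          using inC[OF Z(1)] unfolding X(2) Y(2) r_def Z(2) by auto
        then show "Z \<in> {X, Y}"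
          using bij_betw_imp_inj_on[OF bij] Z(1) X(1) Y(1) by (auto dest: inj_onD)
      qed (use X Y in \<open>auto simp: \<phi>_def r_def\<close>)
      moreover have "y \<in> {1..n - 1}" "X \<subseteq> {1..n - 1}" using CP X(1) Y(1) YX(1) by blast+
      ultimately show "\<exists>j L. j \<in> {1..n - 1} \<and> L \<subseteq> {1..n - 1} \<and> j \<notin> L \<and>
          {Z \<in> C. \<phi> Z = \<phi> K} = {L, insert j L}" using YX by blast
    qed
  qed
qed

theorem theorem4p2p6:
  fixes n :: nat
  assumes "n \<ge> 1"
  shows
    "(\<forall>J. J \<subseteq> {1..n - 1} \<longrightarrow>
        (has_cyclic_descent_extension n (inverse_descent_class n (Pow J)) (Des n)
          \<longleftrightarrow> J \<noteq> {}))
     \<and> (\<forall>I J. I \<subseteq> J \<and> J \<subseteq> {1..n - 1} \<longrightarrow>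
        (has_cyclic_descent_extension n (inverse_descent_class n {I..J}) (Des n)
          \<longleftrightarrow> I \<subset> J))
     \<and> (\<forall>I J C. I \<subseteq> J \<and> J \<subseteq> {1..n - 1} \<and> subset.maxchain {I..J} C \<longrightarrow>
        (has_cyclic_descent_extension n (inverse_descent_class n C) (Des n)
          \<longleftrightarrow> odd (card J - card I)))
     \<and> (\<forall>C. subset.maxchain (Pow {1..n - 1}) C \<longrightarrow>
        (has_cyclic_descent_extension n (inverse_descent_class n C) (Des n)
          \<longleftrightarrow> odd (n - 1)))
     \<and> (odd (n - 1) \<longleftrightarrow> even n)"
proof (intro conjI allI impI)
  have Pow: "Pow J = {{}..J}" for J :: "nat set" by auto
  show "has_cyclic_descent_extension n (inverse_descent_class n (Pow J)) (Des n) \<longleftrightarrow> J \<noteq> {}"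
    if "J \<subseteq> {1..n - 1}" for J
    unfolding Pow using interval_has_cyclic_descent_extension_iff[OF assms empty_subsetI that] by blast
  show "has_cyclic_descent_extension n (inverse_descent_class n C) (Des n) \<longleftrightarrow> odd (n - 1)"
    if "subset.maxchain (Pow {1..n - 1}) C" for C
    using maxchain_has_cyclic_descent_extension_iff[OF assms empty_subsetI order_refl that[unfolded Pow]]
    by simp
qed (use assms interval_has_cyclic_descent_extension_iff maxchain_has_cyclic_descent_extension_iff in auto)

end
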